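(* Let $\Lambda=(\lambda_n)_{n\ge 0}$ be a sequence with $0=\lambda_0<\lambda_n\uparrow+\infty$ ($1\le n\uparrow+\infty$). Let $\Phi_1\in L$, $h\in L^{+}$ and let $\varphi_1$ be the inverse function to $\Phi_1$. The following are equivalent: (i) for every $F\in D_1(\Lambda,\Phi_1)$ there is a set $E\subset[0,+\infty)$ of finite $h$-measure such that the relation $$F(x+iy)=(1+o(1))\,a_{\nu(x,F)}e^{(x+iy)\lambda_{\nu(x,F)}}$$ holds as $x\to+\infty$, $x\notin E$, uniformly in $y\in\mathbb{R}$; (ii) $$(\forall b>0):\quad \sum_{n=0}^{+\infty}\frac{h'(b\varphi_1(b\lambda_n))}{\lambda_{n+1}-\lambda_n}<+\infty.$$
   Context: $L$ is the class of positive continuous functions on $[0,+\infty)$ increasing to $+\infty$; $L^{+}$ is the subclass of differentiable functions in $L$ with non-decreasing derivative. $D(\Lambda)$ is the class of entire Dirichlet series $F(z)=\sum_{n=0}^{+\infty}a_n e^{z\lambda_n}$ (complex coefficients, absolutely convergent in the whole complex plane). For $F\in D(\Lambda)$ and $x\in\mathbb{R}$: $\mu(x,F)=\max\{|a_n|e^{x\lambda_n}:n\ge0\}$ is the maximal term and $\nu(x,F)=\max\{n:|a_n|e^{x\lambda_n}=\mu(x,F)\}$ is the central index. $D_1(\Lambda,\Phi_1)=\{F\in D(\Lambda):\ \text{there are } K_1,K_2>0 \text{ and } x_0 \text{ with } \ln\mu(x,F)\ge K_1x\Phi_1(K_2x)\ \text{for all } x>x_0\}$. The $h$-measure of a measurable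 set $E\subset[0,+\infty)$ is $\int_E dh(x)$. Convention: for each $b$, the finitely many terms of the series for which $\varphi_1(b\lambda_n)$ is not defined (those with $b\lambda_n<\Phi_1(0)$) are disregarded. *)

theory Defs
  imports "HOL-Analysis.Analysis"
begin

text \<open>
  Functions on \<open>[0,+\<infinity>)\<close> are total functions on the reals of which only the
  values on \<open>{0..}\<close> matter. ``Increasing'' (as opposed to ``non-decreasing'') is strict, so
  that members of \<open>L\<close> have an inverse on \<open>{\<Phi> 0..}\<close>.
\<close>

definition class_L :: "(real \<Rightarrow> real) set" where
  "class_L = {\<Phi>. (\<forall>x\<ge>0. 0 < \<Phi> x) \<and> continuous_on {0..} \<Phi> \<and>
                  strict_mono_on {0..} \<Phi> \<and> filterlim \<Phi> at_top at_top}"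

text \<open>The derivative at \<open>0\<close> is one-sided.\<close>

definition deriv_Ici :: "(real \<Rightarrow> real) \<Rightarrow> real \<Rightarrow> real" where
  "deriv_Ici h x = vector_derivative h (at x within {0..})"

definition class_L_plus :: "(real \<Rightarrow> real) set" where
  "class_L_plus = {h \<in> class_L. h differentiable_on {0..} \<and> mono_on {0..} (deriv_Ici h)}"

definition inverse_Ici :: "(real \<Rightarrow> real) \<Rightarrow> real \<Rightarrow> real" where
  "inverse_Ici \<Phi> = inv_into {0..} \<Phi>"

text \<open>
  The Lebesgue--Stieltjes measure \<open>dh\<close>, completed. The function \<open>h\<close> is extended to
  negative arguments by the constant \<open>h 0\<close>, so the negative half-line is a null set and,
  \<open>h\<close> being continuous, there is no atom at \<open>0\<close>. For \<open>h\<close> in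
  \<open>class_L_plus\<close> the measurable subsets of \<open>{0..}\<close> are exactly the Lebesgue
  measurable ones, since \<open>h\<close> is continuously differentiable with positive derivative
  on \<open>{0<..}\<close>.
\<close>

definition h_measure :: "(real \<Rightarrow> real) \<Rightarrow> real measure" where
  "h_measure h = completion (interval_measure (\<lambda>x. h (max 0 x)))"

text \<open>
  A Dirichlet series with exponents \<open>lam\<close> is represented by its coefficient sequence.
\<close>

definition dirichlet_series :: "(nat \<Rightarrow> real) \<Rightarrow> (nat \<Rightarrow> complex) \<Rightarrow> complex \<Rightarrow> complex" where
  "dirichlet_series lam a z = (\<Sum>n. a n * exp (z * of_real (lam n)))"

definition class_D :: "(nat \<Rightarrow> real) \<Rightarrow> (nat \<Rightarrow> complex) set" where
  "class_D lam = {a. \<forall>z::complex. summable (\<lambda>n. norm (a n * exp (z * of_real (lam n))))}"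

text \<open>
  For coefficient sequences in \<open>class_D\<close> the maximum is attained, and unless all
  coefficients vanish it is positive and attained only finitely often.
\<close>

definition max_term :: "(nat \<Rightarrow> real) \<Rightarrow> (nat \<Rightarrow> complex) \<Rightarrow> real \<Rightarrow> real" where
  "max_term lam a x = (GREATEST m. m \<in> range (\<lambda>n. norm (a n) * exp (x * lam n)))"

definition central_index :: "(nat \<Rightarrow> real) \<Rightarrow> (nat \<Rightarrow> complex) \<Rightarrow> real \<Rightarrow> nat" where
  "central_index lam a x = (GREATEST n. norm (a n) * exp (x * lam n) = max_term lam a x)"

text \<open>
  Requiring \<open>x0 \<ge> 0\<close> only keeps the arguments of \<open>\<Phi>\<close> in its domain. The zero
  series is excluded: its maximal term is \<open>0\<close>, \<open>ln 0 = 0\<close>, and the lower bound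
  is positive.
\<close>

definition class_D1 :: "(nat \<Rightarrow> real) \<Rightarrow> (real \<Rightarrow> real) \<Rightarrow> (nat \<Rightarrow> complex) set" where
  "class_D1 lam \<Phi> = {a \<in> class_D lam. \<exists>K1>0. \<exists>K2>0. \<exists>x0\<ge>0. \<forall>x>x0.
     ln (max_term lam a x) \<ge> K1 * x * \<Phi> (K2 * x)}"

text \<open>
  \<open>r\<close> is the \<open>o(1)\<close> term; the filter describes \<open>x \<rightarrow> +\<infinity>\<close> with
  \<open>x \<notin> E\<close>.
\<close>

definition asymp_central_term ::
  "(nat \<Rightarrow> real) \<Rightarrow> (nat \<Rightarrow> complex) \<Rightarrow> real set \<Rightarrow> bool" where
  "asymp_central_term lam a E \<longleftrightarrow>
     (\<exists>r :: real \<Rightarrow> real \<Rightarrow> complex.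
        (\<forall>\<^sub>F x in inf at_top (principal (- E)). \<forall>y.
           dirichlet_series lam a (Complex x y) =
             (1 + r x y) * (a (central_index lam a x) *
               exp (Complex x y * of_real (lam (central_index lam a x))))) \<and>
        uniform_limit UNIV r (\<lambda>_. 0) (inf at_top (principal (- E))))"

end

theory Submission imports Defs begin

text \<open>
  Write \<open>\<phi>\<close> for the inverse of \<open>\<Phi>\<close>, \<open>\<Delta>\<^sub>n = \<lambda>\<^sub>n\<^sub>+\<^sub>1 - \<lambda>\<^sub>n\<close>, and recall
  that \<open>h\<close> is convex, so that an interval \<open>[u, v]\<close> has \<open>h\<close>-measure
  between \<open>h'(u) (v - u)\<close> and \<open>h'(v) (v - u)\<close>. The two largest terms of a series are
  comparable, roughly, only for \<open>x\<close> within \<open>1/\<Delta>\<^sub>n\<close> of the point \<open>R\<^sub>n\<close> where the central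
  index passes from \<open>n\<close> to \<open>n + 1\<close>, and the growth condition on the maximal term says that,
  up to constants, \<open>R\<^sub>n\<close> is at most \<open>\<phi>(\<lambda>\<^sub>n)\<close>. The series in the theorem is thus the
  order of magnitude of the largest \<open>h\<close>-measure that the growth condition permits for the
  exceptional set.

  Suppose that the series converges for every \<open>b\<close>. There is room for a factor \<open>w\<^sub>n\<close>
  that tends to infinity and still leaves \<open>\<Sum> w\<^sub>n h'(b \<phi>(b \<lambda>\<^sub>n)) / \<Delta>\<^sub>n\<close> convergent
  (\<open>exists_divergent_weights\<close>). Put \<open>\<tau>\<^sub>n = w\<^sub>n / \<Delta>\<^sub>n\<close>. As in the Wiman--Valiron method,
  \<open>|a\<^sub>n|\<close> is multiplied by the exponential of a convex function of \<open>\<lambda>\<^sub>n\<close> whose slopes are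
  governed by the partial sums \<open>P\<^sub>n\<close> of \<open>2 \<tau>\<^sub>n\<close>. If the \<open>N\<close>-th term of the lifted
  series is maximal at \<open>x - P\<^sub>N\<close>, then at \<open>x\<close> the \<open>N\<close>-th term of the given series beats the
  \<open>n\<close>-th one by the factor \<open>exp (\<Sum> w\<^sub>k)\<close>, the sum being over the indices between \<open>n\<close> and
  \<open>N\<close> (\<open>isolation_of_lifted_maximizer\<close>), and the sum of all other terms is
  \<open>o(1)\<close> times the \<open>N\<close>-th one. The points \<open>x\<close> not of this kind lie in
  intervals of length \<open>2 \<tau>\<^sub>j\<close> that start at \<open>R\<^sub>j + P\<^sub>j\<close>, where \<open>R\<^sub>j\<close> belongs
  to the lifted series (\<open>maximizer_outside_gaps\<close>), and \<open>R\<^sub>j\<close> obeys the bound by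
  \<open>\<phi>\<close> (\<open>dominated_upto_le\<close>). Their total \<open>h\<close>-measure is finite.

  Suppose that the series diverges for some \<open>b\<close>, and put
  \<open>f\<^sub>n = b \<phi>(b \<lambda>\<^sub>n)\<close>. A series with positive coefficients is
  determined, up to a factor, by the points \<open>R\<^sub>n\<close> at which its terms \<open>n\<close> and \<open>n + 1\<close> are
  equal, and these may be prescribed subject to monotonicity. Any such choice with
  \<open>f\<^sub>n \<le> R\<^sub>n \<le> 2 f\<^sub>n\<close> gives the required growth
  (\<open>jump_series_in_class_D1\<close>), and the asymptotic relation fails at every large \<open>x\<close> with
  \<open>R\<^sub>n < x \<le> R\<^sub>n\<^sub>+\<^sub>1\<close> and \<open>x \<le> R\<^sub>n + 1/\<Delta>\<^sub>n\<close>
  (\<open>jump_series_exceptional\<close>). Overlaps between the intervals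
  \<open>[R\<^sub>n, R\<^sub>n + 1/\<Delta>\<^sub>n]\<close> could make this set small; so \<open>R\<^sub>n\<close> is pushed to the
  right end of the previous interval as long as it stays below \<open>2 f\<^sub>n\<close>. Either the
  intervals are eventually disjoint, and the divergent series bounds the \<open>h\<close>-measure from
  below, or infinitely often all of \<open>(f\<^sub>n, 2 f\<^sub>n]\<close> is covered
  (\<open>greedy_jumps_infinite_h_measure\<close>). When gaps at most \<open>1\<close> occur infinitely often, the
  construction uses a sparse subsequence of the exponents; this secures absolute
  convergence.
\<close>

section \<open>The classes of functions and the measure \<open>dh\<close>\<close>

lemma inverse_Ici_works:
  assumes "\<Phi> \<in> class_L" and "\<Phi> 0 \<le> y"
  shows "0 \<le> inverse_Ici \<Phi> y" and "\<Phi> (inverse_Ici \<Phi> y) = y"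
proof -
  have "eventually (\<lambda>x. y \<le> \<Phi> x) at_top"
    using assms(1) by (simp add: class_L_def filterlim_at_top)
  then obtain B where B: "\<And>x. x \<ge> B \<Longrightarrow> y \<le> \<Phi> x"
    by (auto simp: eventually_at_top_linorder)
  have "\<exists>x. 0 \<le> x \<and> x \<le> max 0 B \<and> \<Phi> x = y"
    using assms by (intro IVT' B) (auto simp: class_L_def intro: continuous_on_subset)
  then have "y \<in> \<Phi> ` {0..}"
    by auto
  then show "0 \<le> inverse_Ici \<Phi> y" "\<Phi> (inverse_Ici \<Phi> y) = y"
    using inv_into_into[of y \<Phi> "{0..}"] f_inv_into_f[of y \<Phi> "{0..}"]
    by (auto simp: inverse_Ici_def)
qed

lemma le_inverse_Ici_iff:
  assumes "\<Phi> \<in> class_L" and "\<Phi> 0 \<le> y" and "0 \<le> x"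
  shows "x \<le> inverse_Ici \<Phi> y \<longleftrightarrow> \<Phi> x \<le> y"
proof -
  note w = inverse_Ici_works[OF assms(1,2)]
  have mono: "strict_mono_on {0..} \<Phi>"
    using assms(1) by (simp add: class_L_def)
  show ?thesis
    using strict_mono_on_less_eq[OF mono, of x "inverse_Ici \<Phi> y"] w assms(3) by simp
qed

lemma inverse_Ici_mono:
  assumes "\<Phi> \<in> class_L" and "\<Phi> 0 \<le> y" and "y \<le> z"
  shows "inverse_Ici \<Phi> y \<le> inverse_Ici \<Phi> z"
  using le_inverse_Ici_iff[OF assms(1), of z "inverse_Ici \<Phi> y"]
    inverse_Ici_works[OF assms(1,2)] assms(2,3) by simp

lemma inverse_Ici_at_top:
  assumes "\<Phi> \<in> class_L"
  shows "filterlim (inverse_Ici \<Phi>) at_top at_top"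
  unfolding filterlim_at_top
proof
  fix Z :: real
  have "\<Phi> 0 \<le> \<Phi> (max 0 Z)"
    using assms by (auto simp: class_L_def intro!: strict_mono_on_leD[of "{0..}" \<Phi>])
  then show "\<forall>\<^sub>F y in at_top. Z \<le> inverse_Ici \<Phi> y"
    by (intro eventually_mono[OF eventually_ge_at_top[of "\<Phi> (max 0 Z)"]]
          order_trans[OF max.cobounded2[of Z 0] iffD2[OF le_inverse_Ici_iff[OF assms]]]) auto
qed

text \<open>
  The derivative is non-decreasing, so the mean value theorem bounds the \<open>h\<close>-measure of an
  interval by its length times the derivative at either end. Every estimate of
  \<open>h\<close>-measure below goes through these two inequalities.
\<close>

lemma class_L_plus_increment:
  assumes "h \<in> class_L_plus" and "0 \<le> u" and "u \<le> v"
  shows "deriv_Ici h u * (v - u) \<le> h v - h u" and "h v - h u \<le> deriv_Ici h v * (v - u)"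
proof -
  have der: "(h has_vector_derivative deriv_Ici h x) (at x within {0..})" if "0 \<le> x" for x
    using assms(1) that unfolding deriv_Ici_def class_L_plus_def
    by (auto simp: vector_derivative_works[symmetric] differentiable_on_def)
  have "(h has_derivative (\<lambda>t. deriv_Ici h x * t)) (at x within {u..v})"
    if "u \<le> x" "x \<le> v" for x
    using has_vector_derivative_within_subset[OF der[of x], of "{u..v}"] assms(2) that
    by (auto simp: has_vector_derivative_def mult.commute)
  then obtain x where x: "x \<in> {u..v}" "h v - h u = deriv_Ici h x * (v - u)"
    using mvt_very_simple[OF assms(3), of h "\<lambda>x t. deriv_Ici h x * t"] by blast
  have mono: "mono_on {0..} (deriv_Ici h)"
    using assms(1) by (simp add: class_L_plus_def)
  have "deriv_Ici h u \<le> deriv_Ici h x" "deriv_Ici h x \<le> deriv_Ici h v"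
    using x(1) assms(2) by (auto intro!: mono_onD[OF mono])
  then show "deriv_Ici h u * (v - u) \<le> h v - h u" "h v - h u \<le> deriv_Ici h v * (v - u)"
    using x(2) assms(3) by (auto intro!: mult_right_mono)
qed

lemma class_L_plus_deriv_pos:
  assumes "h \<in> class_L_plus" and "0 < x"
  shows "0 < deriv_Ici h x"
proof -
  have "h 0 < h x"
    using assms by (auto simp: class_L_plus_def class_L_def intro: strict_mono_onD[of "{0..}" h])
  then have "0 < deriv_Ici h x * x"
    using class_L_plus_increment(2)[OF assms(1), of 0 x] assms(2) by simp
  then show ?thesis
    using assms(2) by (simp add: zero_less_mult_iff)
qed

text \<open>
  At \<open>0\<close> the derivative may vanish, so strict positivity is available only for
  positive arguments.
\<close>

lemma class_L_plus_deriv_nonneg: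
  assumes "h \<in> class_L_plus" and "0 \<le> x"
  shows "0 \<le> deriv_Ici h x"
proof (rule ccontr)
  assume "\<not> 0 \<le> deriv_Ici h x"
  moreover have "(h has_real_derivative deriv_Ici h x) (at x within {0..})"
    using assms unfolding deriv_Ici_def class_L_plus_def
    by (auto simp: has_real_derivative_iff_has_vector_derivative vector_derivative_works[symmetric]
        differentiable_on_def)
  ultimately obtain d where "0 < d" and d: "\<And>e. 0 < e \<Longrightarrow> x + e \<in> {0..} \<Longrightarrow> e < d \<Longrightarrow> h (x + e) < h x"
    using has_real_derivative_neg_dec_right[of h "deriv_Ici h x" x "{0..}"] by auto
  have "h x < h (x + d / 2)"
    using assms \<open>0 < d\<close>
    by (intro strict_mono_onD[of "{0..}" h]) (auto simp: class_L_plus_def class_L_def)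
  then show False
    using d[of "d / 2"] \<open>0 < d\<close> assms(2) by simp
qed

lemma class_L_plus_deriv_mono:
  assumes "h \<in> class_L_plus" and "0 \<le> x" and "x \<le> y"
  shows "deriv_Ici h x \<le> deriv_Ici h y"
  using assms by (auto simp: class_L_plus_def intro!: mono_onD[of "{0..}" "deriv_Ici h"])

context
  fixes h :: "real \<Rightarrow> real"
  assumes h: "h \<in> class_L_plus"
begin

private lemma ext_mono: "x \<le> y \<Longrightarrow> h (max 0 x) \<le> h (max 0 y)"
  using h by (intro strict_mono_on_leD[of "{0..}" h]) (auto simp: class_L_plus_def class_L_def)

private lemma ext_cont: "continuous_on UNIV (\<lambda>x. h (max 0 x))"
proof (rule continuous_on_compose2[of "{0..}" h])
  show "continuous_on {0..} h"
    using h by (simp add: class_L_plus_def class_L_def)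
  show "continuous_on UNIV (\<lambda>x::real. max 0 x)"
    by (intro continuous_intros)
qed auto

lemma sets_h_measure_borel: "A \<in> sets borel \<Longrightarrow> A \<in> sets (h_measure h)"
  unfolding h_measure_def by (rule sets_completionI_sets) simp

lemma emeasure_h_measure_Icc:
  assumes "0 \<le> u" and "u \<le> v"
  shows "emeasure (h_measure h) {u..v} = ennreal (h v - h u)"
proof -
  have "emeasure (interval_measure (\<lambda>x. h (max 0 x))) {u..v} = ennreal (h (max 0 v) - h (max 0 u))"
    by (rule emeasure_interval_measure_Icc[OF assms(2) ext_mono ext_cont])
  then show ?thesis
    using assms by (simp add: h_measure_def emeasure_completion max_def)
qed

lemma emeasure_h_measure_Ioc:
  assumes "0 \<le> u" and "u \<le> v"
  shows "emeasure (h_measure h) {u<..v} = ennreal (h v - h u)"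
proof -
  have "emeasure (interval_measure (\<lambda>x. h (max 0 x))) {u<..v} = ennreal (h (max 0 v) - h (max 0 u))"
  proof (rule emeasure_interval_measure_Ioc[OF assms(2) ext_mono])
    show "continuous (at_right x) (\<lambda>x. h (max 0 x))" for x
      using ext_cont by (simp add: continuous_on_eq_continuous_at continuous_at_imp_continuous_at_within)
  qed
  then show ?thesis
    using assms by (simp add: h_measure_def emeasure_completion max_def)
qed

end

section \<open>Maximal term and central index\<close>

text \<open>
  Some value \<open>u p\<close> is positive unless \<open>u\<close> vanishes, and only finitely many values
  reach it.
\<close>

lemma ex_maximal_if_tendsto_zero:
  fixes u :: "nat \<Rightarrow> real"
  assumes "\<And>n. 0 \<le> u n" and "u \<longlonglongrightarrow> 0"
  shows "\<exists>k. \<forall>n. u n \<le> u k"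
proof (cases "\<exists>p. 0 < u p")
  case True
  then obtain p where p: "0 < u p" ..
  then obtain M where M: "\<And>n. n \<ge> M \<Longrightarrow> u n < u p"
    using order_tendstoD(2)[OF assms(2) p] by (auto simp: eventually_sequentially)
  have "Max (u ` {..max M p}) \<in> u ` {..max M p}"
    by (rule Max_in) auto
  then obtain k where k: "Max (u ` {..max M p}) = u k"
    by blast
  have k: "u n \<le> u k" if "n \<le> max M p" for n
    unfolding k[symmetric] using that by (intro Max_ge) auto
  have "u n \<le> u k" for n
  proof (cases "n \<le> max M p")
    case False
    then show ?thesis
      using M[of n] k[of p] by force
  qed (rule k)
  then show ?thesis by blast
next
  case False
  then have "u n = 0" for n
    using assms(1)[of n] by (metis less_eq_real_def)
  then show ?thesis by auto
qed

lemma class_D_norm_summable: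
  assumes "a \<in> class_D lam"
  shows "summable (\<lambda>n. norm (a n) * exp (x * lam n))"
proof -
  have "summable (\<lambda>n. norm (a n * exp (complex_of_real x * of_real (lam n))))"
    using assms unfolding class_D_def by blast
  then show ?thesis
    by (simp add: norm_mult)
qed

lemma max_term_eqI:
  assumes "\<And>n. norm (a n) * exp (x * lam n) \<le> norm (a N) * exp (x * lam N)"
  shows "max_term lam a x = norm (a N) * exp (x * lam N)"
  unfolding max_term_def using assms by (intro Greatest_equality) auto

lemma max_term_attained:
  assumes "a \<in> class_D lam"
  obtains N where "\<And>n. norm (a n) * exp (x * lam n) \<le> norm (a N) * exp (x * lam N)"
    and "max_term lam a x = norm (a N) * exp (x * lam N)"
proof -
  obtain N where "\<And>n. norm (a n) * exp (x * lam n) \<le> norm (a N) * exp (x * lam N)"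
    using ex_maximal_if_tendsto_zero[OF _ summable_LIMSEQ_zero[OF class_D_norm_summable[OF assms, of x]]]
    by auto
  with that max_term_eqI[of a x lam N, OF this] show thesis
    by blast
qed

lemma term_le_max_term:
  assumes "a \<in> class_D lam"
  shows "norm (a n) * exp (x * lam n) \<le> max_term lam a x"
  by (rule max_term_attained[OF assms, of x]) simp

text \<open>
  A positive maximal term is attained by only finitely many indices, as the terms tend to
  \<open>0\<close>; hence a greatest such index exists.
\<close>

lemma central_index_attains:
  assumes "a \<in> class_D lam" and "0 < max_term lam a x"
  shows "norm (a (central_index lam a x)) * exp (x * lam (central_index lam a x)) = max_term lam a x"
proof -
  have lim: "(\<lambda>n. norm (a n) * exp (x * lam n)) \<longlonglongrightarrow> 0"
    by (rule summable_LIMSEQ_zero[OF class_D_norm_summable[OF assms(1)]])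
  obtain M where "\<And>n. n \<ge> M \<Longrightarrow> norm (a n) * exp (x * lam n) < max_term lam a x"
    using order_tendstoD(2)[OF lim assms(2)] by (auto simp: eventually_sequentially)
  then have "\<And>n. norm (a n) * exp (x * lam n) = max_term lam a x \<Longrightarrow> n \<le> M"
    by (rule_tac leI) (force dest: less_imp_le)
  moreover obtain N where "norm (a N) * exp (x * lam N) = max_term lam a x"
    by (rule max_term_attained[OF assms(1), of x]) simp
  ultimately show ?thesis
    unfolding central_index_def
    by (rule_tac GreatestI_nat[where P = "\<lambda>n. norm (a n) * exp (x * lam n) = max_term lam a x"])
qed

lemma central_index_eqI:
  assumes "\<And>n. n \<noteq> N \<Longrightarrow> norm (a n) * exp (x * lam n) < norm (a N) * exp (x * lam N)"
  shows "central_index lam a x = N"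
proof -
  have le: "norm (a n) * exp (x * lam n) \<le> norm (a N) * exp (x * lam N)" for n
    using assms[of n] by (cases "n = N") auto
  have "n = N" if "norm (a n) * exp (x * lam n) = norm (a N) * exp (x * lam N)" for n
    using assms[of n] that by auto
  then show ?thesis
    unfolding central_index_def max_term_eqI[of a x lam N, OF le] by (intro Greatest_equality) auto
qed

lemma eventually_at_top_inf_principal:
  "eventually P (inf at_top (principal (- E))) \<longleftrightarrow> (\<exists>X::real. \<forall>x\<ge>X. x \<notin> E \<longrightarrow> P x)"
  by (auto simp: eventually_inf_principal eventually_at_top_linorder)

section \<open>Isolation of the maximal term by lifting\<close>

text \<open>
  No convergent series of positive terms converges slowest: dividing \<open>v n\<close> by the
  square root of the tail \<open>t n = v n + v (n + 1) + \<dots>\<close> keeps the series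
  convergent, because \<open>v n / sqrt (t n)\<close> is at most twice the difference of
  consecutive values of \<open>sqrt (t n)\<close>.
\<close>

lemma exists_divergent_weights:
  fixes v :: "nat \<Rightarrow> real"
  assumes pos: "\<And>n. 0 < v n" and "summable v"
  obtains c where "mono c" and "\<And>n. 0 < c n" and "filterlim c at_top sequentially"
    and "summable (\<lambda>n. c n * v n)"
proof -
  define t where "t n = suminf v - sum v {..<n}" for n
  have t_pos: "0 < t n" for n
    using sum_less_suminf[OF assms(2), of n] pos by (simp add: t_def)
  have t_Suc: "t (Suc n) = t n - v n" for n
    by (simp add: t_def)
  have t_lim: "t \<longlonglongrightarrow> 0"
    using tendsto_diff[OF tendsto_const summable_LIMSEQ[OF assms(2)], of "suminf v"]
    by (simp add: t_def[abs_def])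
  have t_anti: "antimono t"
    unfolding decseq_Suc_iff using t_Suc pos by (simp add: less_imp_le)
  define c where "c n = inverse (sqrt (t n))" for n
  have "mono c"
    using t_anti t_pos by (intro monoI) (simp add: c_def antimonoD le_imp_inverse_le)
  moreover have "0 < c n" for n
    using t_pos by (simp add: c_def)
  moreover have "filterlim c at_top sequentially"
    unfolding c_def
  proof (rule filterlim_inverse_at_top)
    show "(\<lambda>n. sqrt (t n)) \<longlonglongrightarrow> 0"
      using tendsto_real_sqrt[OF t_lim] by simp
  qed (simp add: t_pos)
  moreover have "summable (\<lambda>n. c n * v n)"
  proof (rule summableI_nonneg_bounded)
    show "0 \<le> c n * v n" for n
      using \<open>0 < c n\<close> pos[of n] by simp
    have step: "c n * v n \<le> 2 * (sqrt (t n) - sqrt (t (Suc n)))" for n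
    proof -
      define p q where "p = sqrt (t n)" and "q = sqrt (t (Suc n))"
      have pq: "0 < p" "0 < q" "q \<le> p"
        using t_pos[of n] t_pos[of "Suc n"] pos[of n] t_Suc[of n] by (simp_all add: p_def q_def)
      have "v n = p\<^sup>2 - q\<^sup>2"
        using t_pos[of n] t_pos[of "Suc n"] t_Suc[of n] by (simp add: p_def q_def)
      also have "\<dots> = (p - q) * (p + q)"
        by (simp add: power2_eq_square algebra_simps)
      also have "\<dots> \<le> (p - q) * (2 * p)"
        using pq by (intro mult_left_mono) auto
      finally show ?thesis
        using pq by (simp add: c_def p_def[symmetric] q_def[symmetric] field_simps)
    qed
    show "(\<Sum>n<m. c n * v n) \<le> 2 * sqrt (t 0)" for m
    proof -
      have "(\<Sum>n<m. c n * v n) \<le> 2 * (sqrt (t 0) - sqrt (t m))"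
      proof (induction m)
        case (Suc m)
        then show ?case using step[of m] by simp
      qed simp
      then show ?thesis
        using t_pos[of m] by (smt (verit) real_sqrt_gt_0_iff)
    qed
  qed
  ultimately show thesis
    by (rule that)
qed

definition shift :: "(nat \<Rightarrow> real) \<Rightarrow> nat \<Rightarrow> real" where
  "shift \<tau> n = 2 * (\<Sum>k<n. \<tau> k)"

text \<open>
  The logarithm of the factor by which the \<open>n\<close>-th coefficient is multiplied. As a function of
  \<open>lam n\<close> it is piecewise linear with slope \<open>shift \<tau> k + \<tau> k\<close> on the
  \<open>k\<close>-th gap, the midpoint of \<open>shift \<tau> k\<close> and
  \<open>shift \<tau> (Suc k)\<close>. For non-negative
  \<open>\<tau>\<close> the slopes do not decrease, so the function is convex.
\<close>

definition lift_exponent :: "(nat \<Rightarrow> real) \<Rightarrow> (nat \<Rightarrow> real) \<Rightarrow> nat \<Rightarrow> real" where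
  "lift_exponent lam \<tau> n = (\<Sum>k<n. (shift \<tau> k + \<tau> k) * (lam (Suc k) - lam k))"

lemma shift_Suc: "shift \<tau> (Suc n) = shift \<tau> n + 2 * \<tau> n"
  by (simp add: shift_def)

lemma shift_mono: "(\<And>k. 0 \<le> \<tau> k) \<Longrightarrow> m \<le> n \<Longrightarrow> shift \<tau> m \<le> shift \<tau> n"
  unfolding shift_def by (intro mult_left_mono sum_mono2) auto

text \<open>
  The line through the \<open>N\<close>-th vertex with slope \<open>shift \<tau> N\<close> supports the
  convex function \<open>lift_exponent\<close>. On the \<open>k\<close>-th gap the two slopes differ by at
  least \<open>\<tau> k\<close>, on either side of \<open>N\<close>; this is why the slopes are midpoints.
\<close>

lemma lift_exponent_gap:
  assumes "mono lam" and "\<And>k. 0 \<le> \<tau> k"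
  defines "W \<equiv> \<lambda>n. \<Sum>k<n. \<tau> k * (lam (Suc k) - lam k)"
  shows "(shift \<tau> N * lam n - lift_exponent lam \<tau> n) - (shift \<tau> N * lam N - lift_exponent lam \<tau> N)
    \<le> - \<bar>W n - W N\<bar>"
proof -
  define d where "d n = shift \<tau> N * lam n - lift_exponent lam \<tau> n" for n
  have gap: "0 \<le> lam (Suc k) - lam k" for k
    using monoD[OF assms(1), of k "Suc k"] by simp
  have d_Suc: "d (Suc k) - d k = (shift \<tau> N - shift \<tau> k - \<tau> k) * (lam (Suc k) - lam k)" for k
    by (simp add: d_def lift_exponent_def algebra_simps)
  have W_Suc: "W (Suc k) = W k + \<tau> k * (lam (Suc k) - lam k)" for k
    by (simp add: W_def)
  have W_mono: "W m \<le> W n" if "m \<le> n" for m n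
    unfolding W_def using that assms(2) gap by (intro sum_mono2) auto
  have "d n - d N \<le> - \<bar>W n - W N\<bar>"
  proof (cases "N \<le> n")
    case True
    then have "d n - d N \<le> - (W n - W N)"
    proof (induction n rule: dec_induct)
      case (step k)
      have "d (Suc k) - d k \<le> (- \<tau> k) * (lam (Suc k) - lam k)"
        unfolding d_Suc using shift_mono[of \<tau> N k] assms(2) step(1) gap
        by (intro mult_right_mono) auto
      then show ?case
        using step.IH by (simp add: W_Suc)
    qed simp
    then show ?thesis
      using W_mono[OF True] by simp
  next
    case False
    then have le: "n \<le> N" by simp
    then have "d n - d N \<le> - (W N - W n)"
    proof (induction n rule: inc_induct)
      case (step k)
      have "\<tau> k * (lam (Suc k) - lam k) \<le> d (Suc k) - d k"
        unfolding d_Suc using shift_mono[of \<tau> "Suc k" N] assms(2) step(2) gap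
        by (intro mult_right_mono) (auto simp: shift_Suc)
      then show ?case
        using step.IH by (simp add: W_Suc)
    qed simp
    then show ?thesis
      using W_mono[OF le] by simp
  qed
  then show ?thesis
    by (simp add: d_def)
qed

text \<open>
  Undoing the lift and moving the argument from \<open>x\<close> to \<open>x + shift \<tau> N\<close>
  replaces the lifted terms by the original ones and multiplies them by exactly the
  exponential that is controlled by the supporting line.
\<close>

lemma isolation_of_lifted_maximizer:
  fixes A :: "nat \<Rightarrow> real"
  assumes "mono lam" and "\<And>k. 0 \<le> \<tau> k" and "0 \<le> A N"
    and max: "A n * exp (lift_exponent lam \<tau> n) * exp (x * lam n)
                \<le> A N * exp (lift_exponent lam \<tau> N) * exp (x * lam N)"
  defines "W \<equiv> \<lambda>n. \<Sum>k<n. \<tau> k * (lam (Suc k) - lam k)"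
  shows "A n * exp ((x + shift \<tau> N) * lam n)
    \<le> A N * exp ((x + shift \<tau> N) * lam N) * exp (- \<bar>W n - W N\<bar>)"
proof -
  define d where "d n = shift \<tau> N * lam n - lift_exponent lam \<tau> n" for n
  have split: "A n * exp ((x + shift \<tau> N) * lam n)
      = A n * exp (lift_exponent lam \<tau> n) * exp (x * lam n) * exp (d n)" for n
    by (simp add: d_def algebra_simps flip: exp_add)
  have "A n * exp ((x + shift \<tau> N) * lam n)
      \<le> A N * exp (lift_exponent lam \<tau> N) * exp (x * lam N) * exp (d n)"
    unfolding split using max by (intro mult_right_mono) auto
  also have "\<dots> = A N * exp ((x + shift \<tau> N) * lam N) * exp (d n - d N)"
    unfolding split by (simp add: exp_diff)
  also have "\<dots> \<le> A N * exp ((x + shift \<tau> N) * lam N) * exp (- \<bar>W n - W N\<bar>)"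
    using lift_exponent_gap[of lam \<tau> N n, OF assms(1,2)] assms(3)
    by (intro mult_left_mono) (auto simp: W_def d_def)
  finally show ?thesis .
qed

text \<open>
  The weight next to \<open>N\<close> is at least \<open>c (N - 1)\<close>, which gives smallness; the
  remaining ones are at least \<open>c 0\<close>, which gives geometric decay in the distance of
  \<open>n\<close> from \<open>N\<close>. In the exponent this distance is written as
  \<open>(n - N) + (N - n)\<close> with truncated differences.
\<close>

lemma partial_sum_gap_ge:
  fixes c :: "nat \<Rightarrow> real"
  assumes "mono c" and "0 < c 0" and "n \<noteq> N"
  shows "c (N - 1) + real ((n - N) + (N - n) - 1) * c 0 \<le> \<bar>(\<Sum>k<n. c k) - (\<Sum>k<N. c k)\<bar>"
proof -
  have c0: "c 0 \<le> c k" for k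
    using assms(1) by (simp add: monoD)
  have base: "real (n - m) * c 0 \<le> (\<Sum>k<n. c k) - (\<Sum>k<m. c k)" if "m \<le> n" for m n
    using that
  proof (induction n rule: dec_induct)
    case (step k)
    then show ?case using c0[of k] by (simp add: Suc_diff_le algebra_simps)
  qed simp
  show ?thesis
  proof (cases "N < n")
    case True
    have "c (N - 1) \<le> c N"
      using assms(1) by (simp add: monoD)
    then show ?thesis
      using base[of "Suc N" n] True by (simp add: algebra_simps)
  next
    case False
    then have "Suc n \<le> N" "n \<le> N - 1" "N = Suc (N - 1)"
      using assms(3) by auto
    moreover have "(\<Sum>k<N. c k) = (\<Sum>k<N-1. c k) + c (N - 1)"
      by (metis \<open>N = Suc (N - 1)\<close> sum.lessThan_Suc)
    ultimately show ?thesis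
      using base[of n "N - 1"] by (simp add: algebra_simps)
  qed
qed

lemma suminf_minus_term_le:
  fixes t :: "nat \<Rightarrow> real"
  assumes "summable t" and q: "0 \<le> q" "q < 1" and "0 \<le> A"
    and le: "\<And>n. n \<noteq> N \<Longrightarrow> t n \<le> A * q ^ ((n - N) + (N - n) - 1)"
  shows "suminf t - t N \<le> 2 * A / (1 - q)"
proof -
  have geo: "summable (\<lambda>n. q ^ n)" "suminf (\<lambda>n. q ^ n) = 1 / (1 - q)"
    using q by (simp_all add: summable_geometric suminf_geometric)
  have "suminf t = (\<Sum>n. t (n + Suc N)) + (\<Sum>n<N. t n) + t N"
    using suminf_split_initial_segment[OF assms(1), of "Suc N"] by simp
  moreover have "(\<Sum>n. t (n + Suc N)) \<le> (\<Sum>n. A * q ^ n)"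
  proof (rule suminf_le)
    show "t (n + Suc N) \<le> A * q ^ n" for n
      using le[of "n + Suc N"] by simp
    show "summable (\<lambda>n. t (n + Suc N))"
      using assms(1) summable_iff_shift by blast
  qed (rule summable_mult[OF geo(1)])
  moreover have "(\<Sum>n<N. t n) \<le> (\<Sum>n<N. A * q ^ n)"
  proof -
    have "(\<Sum>n<N. t n) = (\<Sum>n<N. t (N - Suc n))"
      by (rule sum.nat_diff_reindex[symmetric])
    also have "\<dots> \<le> (\<Sum>n<N. A * q ^ n)"
    proof (rule sum_mono)
      fix n assume "n \<in> {..<N}"
      then have "N - Suc n \<noteq> N" "(N - Suc n - N) + (N - (N - Suc n)) - 1 = n" by auto
      then show "t (N - Suc n) \<le> A * q ^ n" using le[of "N - Suc n"] by simp
    qed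
    finally show ?thesis .
  qed
  moreover have "(\<Sum>n<N. A * q ^ n) \<le> (\<Sum>n. A * q ^ n)"
    using q assms(4) by (intro sum_le_suminf summable_mult geo) auto
  moreover have "(\<Sum>n. A * q ^ n) = A / (1 - q)"
    using geo by (simp add: suminf_mult)
  ultimately show ?thesis by simp
qed

lemma norm_suminf_minus_term_le:
  fixes f :: "nat \<Rightarrow> complex"
  assumes "summable (\<lambda>n. norm (f n))"
  shows "norm (suminf f - f N) \<le> (\<Sum>n. norm (f n)) - norm (f N)"
proof -
  have f: "(\<lambda>n. f n - (if n = N then f n else 0)) sums (suminf f - f N)"
    by (intro sums_diff summable_sums summable_norm_cancel[OF assms] sums_single)
  have nf: "(\<lambda>n. norm (f n) - (if n = N then norm (f n) else 0)) sums ((\<Sum>n. norm (f n)) - norm (f N))"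
    by (intro sums_diff summable_sums assms sums_single)
  have eq: "norm (f n - (if n = N then f n else 0)) = norm (f n) - (if n = N then norm (f n) else 0)" for n
    by simp
  have "norm (\<Sum>n. f n - (if n = N then f n else 0)) \<le> (\<Sum>n. norm (f n - (if n = N then f n else 0)))"
    using nf by (intro summable_norm) (simp only: eq sums_iff)
  then show ?thesis
    using f nf by (simp only: eq sums_iff)
qed

section \<open>The exceptional set\<close>

text \<open>
  The arguments at which the maximal term of the series with coefficients \<open>b\<close> is
  attained at some index up to \<open>j\<close>. It is an initial segment of the real line, and its
  supremum is the point where the central index exceeds \<open>j\<close> for the first time.
\<close>

definition dominated_upto :: "(nat \<Rightarrow> real) \<Rightarrow> (nat \<Rightarrow> real) \<Rightarrow> nat \<Rightarrow> real set" where
  "dominated_upto lam b j = {x. \<exists>k\<le>j. \<forall>n. b n * exp (x * lam n) \<le> b k * exp (x * lam k)}"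

text \<open>
  With \<open>R (- 1) = - \<infinity>\<close> the \<open>N\<close>-th term is maximal between \<open>R (N - 1)\<close> and
  \<open>R N\<close>. Shifting this interval by \<open>P N\<close> leaves the gaps
  \<open>[R j + P j, R j + P (j + 1)]\<close>, and the shifted intervals together with the gaps
  tile the line. The gaps are taken closed, so that \<open>x - P N\<close> lies strictly between
  the two suprema and it does not matter whether these are attained.
\<close>

lemma maximizer_outside_gaps:
  assumes "strict_mono lam" and b: "\<And>n. 0 \<le> b n"
    and maximizer: "\<And>x. \<exists>k. \<forall>n. b n * exp (x * lam n) \<le> b k * exp (x * lam k)"
    and "\<And>j. J \<le> j \<Longrightarrow> bdd_above (dominated_upto lam b j)"
    and "dominated_upto lam b J \<noteq> {}" and "mono P" and "\<And>n. 0 \<le> P n"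
  defines "R \<equiv> \<lambda>j. Sup (dominated_upto lam b j)"
  assumes "R J + P J < x" and outside: "\<And>j. J \<le> j \<Longrightarrow> x \<notin> {R j + P j..R j + P (Suc j)}"
  obtains N where "J < N"
    and "\<And>n. b n * exp ((x - P N) * lam n) \<le> b N * exp ((x - P N) * lam N)"
proof -
  obtain k where k: "\<And>n. b n * exp ((x + 1) * lam n) \<le> b k * exp ((x + 1) * lam k)"
    using maximizer[of "x + 1"] by blast
  then have "x + 1 \<in> dominated_upto lam b (max k J)"
    by (auto simp: dominated_upto_def intro!: exI[of _ k])
  then have "x + 1 \<le> R (max k J)"
    unfolding R_def using assms(4)[of "max k J"] by (intro cSup_upper) auto
  then have ex: "J \<le> max k J \<and> x < R (max k J) + P (max k J)"
    using assms(7)[of "max k J"] by simp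
  define N where "N = (LEAST N. J \<le> N \<and> x < R N + P N)"
  have N: "J \<le> N" "x < R N + P N"
    using LeastI[of "\<lambda>N. J \<le> N \<and> x < R N + P N", OF ex] unfolding N_def by auto
  have N_least: "R m + P m \<le> x" if "J \<le> m" "m < N" for m
    using not_less_Least[of m "\<lambda>N. J \<le> N \<and> x < R N + P N"] that unfolding N_def by auto
  have "N \<noteq> J"
    using N(2) assms(9) by auto
  then obtain M where M: "N = Suc M" "J \<le> M"
    using N(1) by (cases N) auto
  have above: "R M + P N < x"
    using outside[OF M(2)] N_least[OF M(2)] M(1) by auto
  define z where "z = x - P N"
  have not_M: "z \<notin> dominated_upto lam b M"
  proof
    assume "z \<in> dominated_upto lam b M"
    then have "z \<le> R M"
      unfolding R_def using assms(4)[OF M(2)] by (intro cSup_upper)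
    then show False using above by (simp add: z_def)
  qed
  have "dominated_upto lam b J \<subseteq> dominated_upto lam b N"
    using N(1) by (auto simp: dominated_upto_def) (meson order_trans)
  then have "dominated_upto lam b N \<noteq> {}"
    using assms(5) by blast
  moreover have "z < R N"
    using N(2) by (simp add: z_def)
  ultimately obtain z' where z': "z' \<in> dominated_upto lam b N" "z < z'"
    unfolding R_def using less_cSupE by blast
  then obtain k where k: "k \<le> N" "\<And>n. b n * exp (z' * lam n) \<le> b k * exp (z' * lam k)"
    by (auto simp: dominated_upto_def)
  obtain p where p: "\<And>n. b n * exp (z * lam n) \<le> b p * exp (z * lam p)"
    using maximizer by blast
  \<comment> \<open>Passing from \<open>z\<close> up to \<open>z'\<close> favours larger exponents, yet \<open>k\<close> wins at \<open>z'\<close>.\<close>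
  have k_max: "b n * exp (z * lam n) \<le> b k * exp (z * lam k)" if pN: "p > N" for n
  proof -
    have "lam k \<le> lam p"
      using pN k(1) assms(1) by (simp add: strict_mono_less_eq)
    have "b p * exp (z * lam p) = b p * exp (z' * lam p) * exp ((z - z') * lam p)"
      by (simp add: algebra_simps flip: exp_add)
    also have "\<dots> \<le> b k * exp (z' * lam k) * exp ((z - z') * lam k)"
      using z'(2) \<open>lam k \<le> lam p\<close> b[of k] by (intro mult_mono k) (auto intro: mult_left_mono_neg)
    also have "\<dots> = b k * exp (z * lam k)"
      by (simp add: algebra_simps flip: exp_add)
    finally show ?thesis using p[of n] by simp
  qed
  moreover have "k = N" if "p > N"
  proof (rule ccontr)
    assume "k \<noteq> N"
    then have "k \<le> M" using k(1) M(1) by simp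
    then have "z \<in> dominated_upto lam b M"
      using k_max[OF that] by (auto simp: dominated_upto_def)
    with not_M show False by simp
  qed
  moreover have "N \<le> p"
  proof (rule ccontr)
    assume "\<not> N \<le> p"
    then have "z \<in> dominated_upto lam b M"
      using p M(1) by (auto simp: dominated_upto_def intro!: exI[of _ p])
    with not_M show False by simp
  qed
  ultimately have "b n * exp (z * lam n) \<le> b N * exp (z * lam N)" for n
    using p by (cases "p = N") auto
  then show thesis
    using that[of N] M z_def by auto
qed

text \<open>
  All terms have absolute values independent of \<open>y\<close>, so a bound for the sum of the
  absolute values of the non-central terms is uniform in \<open>y\<close>.
\<close>

lemma asymp_central_termI:
  assumes "a \<in> class_D lam" and "\<epsilon> \<longlonglongrightarrow> 0"
    and dominant: "\<And>j. J \<le> j \<Longrightarrow> \<exists>X. \<forall>x\<ge>X. x \<notin> E \<longrightarrow>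
      (\<exists>N\<ge>j. a N \<noteq> 0 \<and> central_index lam a x = N \<and>
        (\<Sum>n. norm (a n) * exp (x * lam n)) - norm (a N) * exp (x * lam N)
          \<le> \<epsilon> N * (norm (a N) * exp (x * lam N)))"
  shows "asymp_central_term lam a E"
proof -
  define T where "T x y = a (central_index lam a x)
      * exp (Complex x y * of_real (lam (central_index lam a x)))" for x y
  define r where "r x y = dirichlet_series lam a (Complex x y) / T x y - 1" for x y
  have norm_term: "norm (a n * exp (Complex x y * of_real (lam n))) = norm (a n) * exp (x * lam n)" for n x y
    by (simp add: norm_mult)
  have bound: "T x y \<noteq> 0 \<and> norm (r x y) \<le> \<epsilon> N"
    if "a N \<noteq> 0" "central_index lam a x = N"
      "(\<Sum>n. norm (a n) * exp (x * lam n)) - norm (a N) * exp (x * lam N)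
          \<le> \<epsilon> N * (norm (a N) * exp (x * lam N))" for N x y
  proof -
    have T: "T x y = a N * exp (Complex x y * of_real (lam N))" "T x y \<noteq> 0"
      using that by (simp_all add: T_def)
    have "summable (\<lambda>n. norm (a n * exp (Complex x y * of_real (lam n))))"
      using assms(1) by (simp add: class_D_def)
    from norm_suminf_minus_term_le[OF this, of N] that(3)
    have "norm (dirichlet_series lam a (Complex x y) - T x y) \<le> \<epsilon> N * norm (T x y)"
      unfolding T(1) norm_term dirichlet_series_def by simp
    moreover have "r x y = (dirichlet_series lam a (Complex x y) - T x y) / T x y"
      using T(2) by (simp add: r_def diff_divide_distrib)
    ultimately show ?thesis
      using T(2) by (simp add: norm_divide pos_divide_le_eq)
  qed
  have "\<forall>\<^sub>F x in inf at_top (principal (- E)). \<forall>y.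
      dirichlet_series lam a (Complex x y) = (1 + r x y) * T x y"
  proof -
    obtain X where "\<forall>x\<ge>X. x \<notin> E \<longrightarrow> (\<forall>y. T x y \<noteq> 0)"
      using dominant[OF order_refl] bound by blast
    then show ?thesis
      unfolding eventually_at_top_inf_principal r_def by auto
  qed
  moreover have "uniform_limit UNIV r (\<lambda>_. 0) (inf at_top (principal (- E)))"
    unfolding uniform_limit_iff
  proof (intro allI impI)
    fix e :: real assume "0 < e"
    then obtain j where j: "\<And>N. j \<le> N \<Longrightarrow> \<epsilon> N < e"
      using order_tendstoD(2)[OF assms(2)] by (auto simp: eventually_sequentially)
    obtain X where X: "\<forall>x\<ge>X. x \<notin> E \<longrightarrow>
      (\<exists>N\<ge>max j J. a N \<noteq> 0 \<and> central_index lam a x = N \<and>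
        (\<Sum>n. norm (a n) * exp (x * lam n)) - norm (a N) * exp (x * lam N)
          \<le> \<epsilon> N * (norm (a N) * exp (x * lam N)))"
      using dominant[of "max j J"] by auto
    have "norm (r x y) < e" if x: "x \<ge> X" "x \<notin> E" for x y
    proof -
      obtain N where N: "N \<ge> max j J" "a N \<noteq> 0" "central_index lam a x = N"
        "(\<Sum>n. norm (a n) * exp (x * lam n)) - norm (a N) * exp (x * lam N)
          \<le> \<epsilon> N * (norm (a N) * exp (x * lam N))"
        using X x by blast
      have "norm (r x y) \<le> \<epsilon> N"
        using bound[OF N(2-4), of y] by blast
      also have "\<dots> < e"
        using N(1) by (intro j) simp
      finally show ?thesis .
    qed
    then show "\<forall>\<^sub>F x in inf at_top (principal (- E)). \<forall>y\<in>UNIV. dist (r x y) 0 < e"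
      unfolding eventually_at_top_inf_principal by auto
  qed
  ultimately show ?thesis
    unfolding asymp_central_term_def T_def by blast
qed

lemma emeasure_h_measure_gaps_finite:
  assumes h: "h \<in> class_L_plus"
    and u: "\<And>i. 0 \<le> u i" and uv: "\<And>i. u i \<le> v i"
    and le: "\<And>i. deriv_Ici h (v i) * (v i - u i) \<le> w i" and "summable w"
  shows "emeasure (h_measure h) (\<Union>i::nat. {u i..v i}) < \<infinity>"
proof -
  have diff_le: "h (v i) - h (u i) \<le> w i" for i
    using class_L_plus_increment(2)[OF h u uv] le by (rule order_trans)
  have "h (u i) \<le> h (v i)" for i
    using h u[of i] uv[of i]
    by (intro strict_mono_on_leD[of "{0..}" h]) (auto simp: class_L_plus_def class_L_def)
  then have w0: "0 \<le> w i" for i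
    using diff_le[of i] by (smt (verit))
  have "emeasure (h_measure h) (\<Union>i. {u i..v i}) \<le> (\<Sum>i. emeasure (h_measure h) {u i..v i})"
    by (rule emeasure_subadditive_countably) (auto intro!: sets_h_measure_borel[OF h])
  also have "\<dots> \<le> (\<Sum>i. ennreal (w i))"
    unfolding emeasure_h_measure_Icc[OF h u uv] using diff_le by (intro suminf_le ennreal_leI) auto
  also have "\<dots> = ennreal (suminf w)"
    using w0 assms(5) by (intro suminf_ennreal2) auto
  finally show ?thesis
    by (simp add: order_le_less_trans)
qed

text \<open>
  The step where the growth condition enters. At a point \<open>x\<close> of this set the maximal term of
  the lifted series, hence also that of the given one, is at most
  \<open>M exp (x * lam j)\<close>, so that \<open>K1 x \<Phi>(K2 x) \<le> M + x * lam j \<le> 2 x * lam j\<close>;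
  then \<open>\<Phi>\<close> is inverted. The factor \<open>c / 2\<close> in place of \<open>c\<close> leaves room
  for the bounded shift.
\<close>

lemma dominated_upto_le:
  assumes lam: "strict_mono lam" "lam 0 = 0" and \<Phi>: "\<Phi> \<in> class_L" and aD: "a \<in> class_D lam"
    and K: "0 < K1" "0 < K2" "0 \<le> x0"
    and growth: "\<And>x. x0 < x \<Longrightarrow> K1 * x * \<Phi> (K2 * x) \<le> ln (max_term lam a x)"
    and b: "\<And>n. norm (a n) \<le> b n" "\<And>n. b n \<le> M" and "0 \<le> M" and "M \<le> lam j"
    and c: "2 / K1 \<le> c" "2 / K2 \<le> c" and "\<Phi> 0 \<le> c * lam j"
    and large: "1 + x0 \<le> c / 2 * inverse_Ici \<Phi> (c * lam j)"
    and x: "x \<in> dominated_upto lam b j"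
  shows "x \<le> c / 2 * inverse_Ici \<Phi> (c * lam j)"
proof (cases "x \<le> 1 + x0")
  case False
  then have x1: "1 \<le> x" "x0 < x" "0 \<le> K2 * x"
    using K by auto
  have lam0: "0 \<le> lam j"
    using assms(11,12) by linarith
  obtain k where k: "k \<le> j" "\<And>n. b n * exp (x * lam n) \<le> b k * exp (x * lam k)"
    using x by (auto simp: dominated_upto_def)
  obtain n where n: "max_term lam a x = norm (a n) * exp (x * lam n)"
    by (rule max_term_attained[OF aD, of x])
  have \<Phi>_pos: "0 < \<Phi> (K2 * x)"
    using \<Phi> x1(3) by (simp add: class_L_def)
  have "0 < K1 * x * \<Phi> (K2 * x)"
    using \<Phi>_pos K x1 by simp
  then have "ln (max_term lam a x) \<noteq> 0"
    using growth[OF x1(2)] by linarith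
  then have pos: "0 < max_term lam a x"
    unfolding n by (cases "a n = 0") auto
  have "max_term lam a x \<le> b n * exp (x * lam n)"
    unfolding n using b(1) by (intro mult_right_mono) auto
  also have "\<dots> \<le> b k * exp (x * lam k)"
    by (rule k)
  also have "\<dots> \<le> exp M * exp (x * lam j)"
  proof (rule mult_mono)
    show "b k \<le> exp M"
      using b(2)[of k] exp_ge_add_one_self[of M] by linarith
    show "exp (x * lam k) \<le> exp (x * lam j)"
      using x1 k(1) lam by (simp add: strict_mono_less_eq)
  qed auto
  finally have "ln (max_term lam a x) \<le> ln (exp (M + x * lam j))"
    using pos by (subst ln_le_cancel_iff) (auto simp: exp_add)
  then have "K1 * x * \<Phi> (K2 * x) \<le> M + x * lam j"
    using growth[OF x1(2)] by simp
  also have "\<dots> \<le> x * (2 * lam j)"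
    using mult_mono[OF x1(1) assms(12)] lam0 assms(11) x1 by simp
  finally have "x * (K1 * \<Phi> (K2 * x)) \<le> x * (2 * lam j)"
    by (simp add: algebra_simps)
  then have "K1 * \<Phi> (K2 * x) \<le> 2 * lam j"
    using x1 by simp
  then have "\<Phi> (K2 * x) \<le> 2 / K1 * lam j"
    using K by (simp add: field_simps)
  also have "\<dots> \<le> c * lam j"
    using c lam0 by (intro mult_right_mono)
  finally have K2x: "K2 * x \<le> inverse_Ici \<Phi> (c * lam j)"
    using le_inverse_Ici_iff[OF \<Phi> assms(15) x1(3)] by simp
  have c_pos: "0 < c"
    using c(1) K(1) by (meson divide_pos_pos less_le_trans zero_less_numeral)
  have "1 \<le> c / 2 * K2"
    using c(2) K by (simp add: field_simps)
  then have "1 * x \<le> (c / 2 * K2) * x"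
    using x1 by (intro mult_right_mono) auto
  also have "\<dots> = c / 2 * (K2 * x)"
    by simp
  also have "\<dots> \<le> c / 2 * inverse_Ici \<Phi> (c * lam j)"
    using K2x c_pos by (intro mult_left_mono) auto
  finally show ?thesis by simp
qed (use large in simp)

text \<open>
  The numerators \<open>h'(c \<phi>(c \<lambda>\<^sub>n))\<close> are eventually bounded below by
  \<open>h' c > 0\<close>. This makes the total shift finite.
\<close>

lemma summable_inverse_gaps:
  assumes \<Phi>: "\<Phi> \<in> class_L" and h: "h \<in> class_L_plus" and "0 < c"
    and lam: "strict_mono lam" "filterlim lam at_top sequentially"
    and "summable (\<lambda>n. if c * lam n < \<Phi> 0 then 0
            else deriv_Ici h (c * inverse_Ici \<Phi> (c * lam n)) / (lam (Suc n) - lam n))"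
  shows "summable (\<lambda>n. 1 / (lam (Suc n) - lam n))"
proof -
  define \<kappa> where "\<kappa> = deriv_Ici h c"
  have \<kappa>: "0 < \<kappa>"
    unfolding \<kappa>_def using h assms(3) by (rule class_L_plus_deriv_pos)
  have gap: "0 < lam (Suc n) - lam n" for n
    using lam(1) by (simp add: strict_mono_less)
  have "\<forall>\<^sub>F n in sequentially. \<Phi> 1 / c \<le> lam n"
    using lam(2) by (simp add: filterlim_at_top)
  then have "\<forall>\<^sub>F n in sequentially. norm (1 / (lam (Suc n) - lam n)) \<le>
      1 / \<kappa> * (if c * lam n < \<Phi> 0 then 0
            else deriv_Ici h (c * inverse_Ici \<Phi> (c * lam n)) / (lam (Suc n) - lam n))"
  proof eventually_elim
    case (elim n)
    have "\<Phi> 0 < \<Phi> 1"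
      using \<Phi> by (intro strict_mono_onD[of "{0..}" \<Phi>]) (auto simp: class_L_def)
    then have ge: "\<Phi> 1 \<le> c * lam n" "\<Phi> 0 \<le> c * lam n"
      using elim assms(3) by (auto simp: field_simps)
    then have "1 \<le> inverse_Ici \<Phi> (c * lam n)"
      using le_inverse_Ici_iff[OF \<Phi>, of "c * lam n" 1] by simp
    then have "\<kappa> \<le> deriv_Ici h (c * inverse_Ici \<Phi> (c * lam n))"
      unfolding \<kappa>_def using assms(3) by (intro class_L_plus_deriv_mono[OF h]) auto
    then have "1 / (lam (Suc n) - lam n)
        \<le> deriv_Ici h (c * inverse_Ici \<Phi> (c * lam n)) / \<kappa> / (lam (Suc n) - lam n)"
      using \<kappa> gap[of n] by (intro divide_right_mono) auto
    then show ?case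
      using ge gap[of n] \<kappa> by (simp add: mult.commute)
  qed
  then show ?thesis
    by (rule summable_comparison_test_ev[OF _ summable_mult[OF assms(6)]])
qed

text \<open>
  The constant \<open>c\<close> comes from the growth constants of the Dirichlet series, which are
  arbitrary; so convergence must be available for every \<open>c\<close>. The convergent series and the
  summable \<open>1 / \<Delta>\<^sub>n\<close> are fed jointly into the choice of the weights: the first makes the
  \<open>h\<close>-measure of the gaps finite, the second makes the shifts bounded, so that the lifted
  series has maximal terms and the gaps stay within \<open>[0, c \<phi>(c \<lambda>\<^sub>j)]\<close>.
\<close>

lemma gap_condition_imp_asymp:
  assumes lam: "lam 0 = 0" "strict_mono lam" "filterlim lam at_top sequentially"
    and \<Phi>: "\<Phi> \<in> class_L" and h: "h \<in> class_L_plus"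
    and conv: "\<And>c. 0 < c \<Longrightarrow> summable (\<lambda>n. if c * lam n < \<Phi> 0 then 0
            else deriv_Ici h (c * inverse_Ici \<Phi> (c * lam n)) / (lam (Suc n) - lam n))"
    and a: "a \<in> class_D1 lam \<Phi>"
  shows "\<exists>E \<in> sets (h_measure h). E \<subseteq> {0..} \<and> emeasure (h_measure h) E < \<infinity> \<and> asymp_central_term lam a E"
proof -
  from a obtain K1 K2 x0 where aD: "a \<in> class_D lam" and K: "0 < K1" "0 < K2" "0 \<le> x0"
    and growth: "\<And>x. x0 < x \<Longrightarrow> K1 * x * \<Phi> (K2 * x) \<le> ln (max_term lam a x)"
    by (auto simp: class_D1_def)
  define c where "c = max (2 / K1) (2 / K2)"
  have c: "2 / K1 \<le> c" "2 / K2 \<le> c" "0 < c"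
    using K by (auto simp: c_def less_max_iff_disj)
  have gap: "0 < lam (Suc n) - lam n" for n
    using lam(2) by (simp add: strict_mono_less)
  have lam_mono: "mono lam"
    using lam(2) by (rule strict_mono_mono)
  define t where "t n = (if c * lam n < \<Phi> 0 then 0
            else deriv_Ici h (c * inverse_Ici \<Phi> (c * lam n)) / (lam (Suc n) - lam n))" for n
  have t_summable: "summable t"
    unfolding t_def using c(3) by (rule conv)
  have t0: "0 \<le> t n" for n
    unfolding t_def using gap[of n] c(3) inverse_Ici_works(1)[OF \<Phi>]
    by (auto intro!: divide_nonneg_pos class_L_plus_deriv_nonneg[OF h] mult_nonneg_nonneg)
  define v where "v n = t n + 1 / (lam (Suc n) - lam n)" for n
  have "0 < v n" for n
    using t0[of n] gap[of n] by (simp add: v_def add_nonneg_pos)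
  moreover have "summable v"
    unfolding v_def using summable_inverse_gaps[OF \<Phi> h c(3) lam(2,3) t_summable[unfolded t_def]]
    by (intro summable_add t_summable)
  ultimately obtain w where w: "mono w" "\<And>n. 0 < w n" "filterlim w at_top sequentially"
    and wv: "summable (\<lambda>n. w n * v n)"
    by (rule exists_divergent_weights) (rule that)
  define \<tau> where "\<tau> n = w n / (lam (Suc n) - lam n)" for n
  have \<tau>0: "0 \<le> \<tau> n" for n
    using w(2)[of n] gap[of n] by (simp add: \<tau>_def)
  have \<tau>_le: "\<tau> n \<le> w n * v n" for n
    using t0[of n] w(2)[of n] by (simp add: \<tau>_def v_def algebra_simps)
  have \<tau>_summable: "summable \<tau>"
    by (rule summable_comparison_test'[OF wv, of 0]) (use \<tau>_le \<tau>0 in auto)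
  have W: "(\<Sum>k<n. \<tau> k * (lam (Suc k) - lam k)) = (\<Sum>k<n. w k)" for n
    using gap by (intro sum.cong) (auto simp: \<tau>_def less_imp_neq[symmetric])
  define P where "P = shift \<tau>"
  define S where "S = 2 * suminf \<tau>"
  have P0: "0 \<le> P n" for n
    using \<tau>0 by (auto simp: P_def shift_def intro!: sum_nonneg)
  have PS: "P n \<le> S" for n
    using sum_le_suminf[OF \<tau>_summable, of "{..<n}"] \<tau>0 by (simp add: P_def S_def shift_def)
  have P_mono: "mono P"
    unfolding P_def using \<tau>0 by (intro monoI shift_mono)
  define b where "b n = norm (a n) * exp (lift_exponent lam \<tau> n)" for n
  have b0: "0 \<le> b n" for n
    by (simp add: b_def)
  have lift_nonneg: "0 \<le> lift_exponent lam \<tau> n" for n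
    unfolding lift_exponent_def using P0 \<tau>0 gap[THEN less_imp_le]
    by (intro sum_nonneg mult_nonneg_nonneg add_nonneg_nonneg) (auto simp: P_def)
  have lift_le: "lift_exponent lam \<tau> n \<le> S * lam n" for n
  proof -
    have "shift \<tau> k + \<tau> k \<le> S" for k
      using PS[of "Suc k"] \<tau>0[of k] by (simp add: P_def shift_Suc)
    then have "lift_exponent lam \<tau> n \<le> (\<Sum>k<n. S * (lam (Suc k) - lam k))"
      unfolding lift_exponent_def using gap[THEN less_imp_le] by (intro sum_mono mult_right_mono)
    also have "\<dots> = S * lam n"
      using lam(1) by (simp add: sum_distrib_left[symmetric] sum_lessThan_telescope)
    finally show ?thesis .
  qed
  have ab: "norm (a n) \<le> b n" for n
    using lift_nonneg[of n] mult_left_mono[of 1 "exp (lift_exponent lam \<tau> n)" "norm (a n)"]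
    by (simp add: b_def)
  obtain m where m: "a m \<noteq> 0"
  proof (rule ccontr)
    assume "\<not> thesis"
    then have zero: "a n = 0" for n
      using that by blast
    have "max_term lam a (x0 + 1) = 0"
      by (rule max_term_attained[OF aD, of "x0 + 1"]) (simp add: zero)
    moreover have "0 < K1 * (x0 + 1) * \<Phi> (K2 * (x0 + 1))"
      using K \<Phi> by (simp add: class_L_def)
    ultimately show False
      using growth[of "x0 + 1"] by simp
  qed
  have maximizer: "\<exists>k. \<forall>n. b n * exp (x * lam n) \<le> b k * exp (x * lam k)" for x
  proof (rule ex_maximal_if_tendsto_zero)
    show "(\<lambda>n. b n * exp (x * lam n)) \<longlonglongrightarrow> 0"
    proof (rule tendsto_sandwich[OF _ _ tendsto_const])
      show "(\<lambda>n. norm (a n) * exp ((x + S) * lam n)) \<longlonglongrightarrow> 0"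
        by (rule summable_LIMSEQ_zero[OF class_D_norm_summable[OF aD]])
      have "b n * exp (x * lam n) \<le> norm (a n) * exp ((x + S) * lam n)" for n
        using lift_le[of n]
        by (auto simp: b_def mult.assoc algebra_simps simp flip: exp_add intro!: mult_left_mono)
      then show "\<forall>\<^sub>F n in sequentially. b n * exp (x * lam n) \<le> norm (a n) * exp ((x + S) * lam n)"
        by simp
    qed (simp add: b0)
  qed (simp add: b0)
  obtain p where p: "\<And>n. b n \<le> b p"
    using maximizer[of 0] by auto
  have arg: "filterlim (\<lambda>j. c * lam j) at_top sequentially"
    using c(3) lam(3) by (rule filterlim_tendsto_pos_mult_at_top[OF tendsto_const])
  have inv: "filterlim (\<lambda>j. inverse_Ici \<Phi> (c * lam j)) at_top sequentially"
    by (rule filterlim_compose[OF inverse_Ici_at_top[OF \<Phi>] arg])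
  have "\<forall>\<^sub>F j in sequentially. b p \<le> lam j \<and> \<Phi> 0 \<le> c * lam j
      \<and> 2 / c * (1 + x0 + S) \<le> inverse_Ici \<Phi> (c * lam j)"
    using lam(3) arg inv unfolding filterlim_at_top by (intro eventually_conj) auto
  then obtain J0 where J0: "\<And>j. J0 \<le> j \<Longrightarrow> b p \<le> lam j" "\<And>j. J0 \<le> j \<Longrightarrow> \<Phi> 0 \<le> c * lam j"
    "\<And>j. J0 \<le> j \<Longrightarrow> 2 / c * (1 + x0 + S) \<le> inverse_Ici \<Phi> (c * lam j)"
    unfolding eventually_sequentially by auto
  have S0: "0 \<le> S"
    using PS[of 0] P0[of 0] by simp
  have large: "1 + x0 + S \<le> c / 2 * inverse_Ici \<Phi> (c * lam j)" if "J0 \<le> j" for j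
    using J0(3)[OF that] c(3) by (simp add: field_simps)
  \<comment> \<open>Since \<open>p\<close> maximizes at \<open>0\<close>, the point \<open>0\<close> lies in every \<open>dominated_upto lam b j\<close> with \<open>p \<le> j\<close>.\<close>
  define J where "J = max J0 p"
  define R where "R j = Sup (dominated_upto lam b j)" for j
  have dom_le: "x \<le> c / 2 * inverse_Ici \<Phi> (c * lam j)"
    if "J \<le> j" "x \<in> dominated_upto lam b j" for x j
  proof (rule dominated_upto_le[OF lam(2,1) \<Phi> aD K growth ab p b0 _ c(1,2) _ _ that(2)])
    have "J0 \<le> j"
      using that(1) by (simp add: J_def)
    then show "b p \<le> lam j" "\<Phi> 0 \<le> c * lam j" "1 + x0 \<le> c / 2 * inverse_Ici \<Phi> (c * lam j)"
      using J0(1,2)[of j] large[of j] S0 by auto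
  qed
  have bdd: "bdd_above (dominated_upto lam b j)" if "J \<le> j" for j
    using dom_le[OF that] by (rule bdd_aboveI)
  have dom0: "0 \<in> dominated_upto lam b j" if "J \<le> j" for j
    using p that by (auto simp: dominated_upto_def J_def intro!: exI[of _ p])
  have R: "0 \<le> R j" "R j \<le> c / 2 * inverse_Ici \<Phi> (c * lam j)" if "J \<le> j" for j
  proof -
    show "0 \<le> R j"
      unfolding R_def by (rule cSup_upper[OF dom0[OF that] bdd[OF that]])
    show "R j \<le> c / 2 * inverse_Ici \<Phi> (c * lam j)"
      unfolding R_def using dom0[OF that] dom_le[OF that] by (intro cSup_least) auto
  qed
  define u where "u j = R j + P j" for j
  define v' where "v' j = R j + P (Suc j)" for j
  define B where "B = (\<Union>i. {u (i + J)..v' (i + J)})"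
  define E where "E = {0..u J} \<union> B"
  have uv: "0 \<le> u (i + J)" "u (i + J) \<le> v' (i + J)" for i
    using R(1)[of "i + J"] P0[of "i + J"] monoD[OF P_mono, of "i + J" "Suc (i + J)"]
    by (simp_all add: u_def v'_def)
  have "emeasure (h_measure h) B < \<infinity>"
    unfolding B_def
  proof (rule emeasure_h_measure_gaps_finite[OF h uv])
    show "summable (\<lambda>i. 2 * (w (i + J) * v (i + J)))"
      using summable_ignore_initial_segment[OF wv, of J] by (rule summable_mult)
    fix i
    define j where "j = i + J"
    have j: "J \<le> j" "J0 \<le> j" by (simp_all add: j_def J_def)
    have "v' j \<le> c * inverse_Ici \<Phi> (c * lam j)"
      using R(2)[OF j(1)] PS[of "Suc j"] large[OF j(2)] K by (simp add: v'_def)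
    then have "deriv_Ici h (v' j) \<le> deriv_Ici h (c * inverse_Ici \<Phi> (c * lam j))"
      using uv[of i] by (intro class_L_plus_deriv_mono[OF h]) (auto simp: j_def)
    then have "deriv_Ici h (v' j) * (2 * \<tau> j) \<le> deriv_Ici h (c * inverse_Ici \<Phi> (c * lam j)) * (2 * \<tau> j)"
      using \<tau>0[of j] by (intro mult_right_mono) auto
    also have "\<dots> = 2 * (w j * t j)"
      using J0(2)[OF j(2)] by (simp add: t_def \<tau>_def)
    also have "\<dots> \<le> 2 * (w j * v j)"
      using w(2)[of j] gap[of j] by (simp add: v_def)
    finally show "deriv_Ici h (v' (i + J)) * (v' (i + J) - u (i + J)) \<le> 2 * (w (i + J) * v (i + J))"
      by (simp add: j_def[symmetric]) (simp add: u_def v'_def P_def shift_Suc)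
  qed
  moreover have B: "B \<in> sets (h_measure h)"
    unfolding B_def by (intro sets_h_measure_borel[OF h]) auto
  moreover have I: "{0..u J} \<in> sets (h_measure h)"
    by (intro sets_h_measure_borel[OF h]) auto
  moreover have "emeasure (h_measure h) {0..u J} < \<infinity>"
    using uv(1)[of 0] by (simp add: emeasure_h_measure_Icc[OF h])
  ultimately have "emeasure (h_measure h) E < \<infinity>"
    unfolding E_def by (intro order_le_less_trans[OF emeasure_subadditive]) auto
  moreover have "E \<in> sets (h_measure h)"
    unfolding E_def using B I by (rule sets.Un[rotated])
  moreover have "E \<subseteq> {0..}"
  proof
    fix x assume "x \<in> E"
    then consider "0 \<le> x" | i where "u (i + J) \<le> x"
      unfolding E_def B_def by auto
    then show "x \<in> {0..}"
      using uv(1) by cases (simp, metis atLeast_iff order_trans)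
  qed
  moreover have "asymp_central_term lam a E"
  proof (rule asymp_central_termI[OF aD])
    define q where "q = exp (- w 0)"
    have q: "0 < q" "q < 1"
      using w(2)[of 0] by (simp_all add: q_def)
    define \<epsilon> where "\<epsilon> N = 2 * exp (- w (N - 1)) / (1 - q)" for N
    have "(\<lambda>N. exp (- w N)) \<longlonglongrightarrow> 0"
      by (rule filterlim_compose[OF exp_at_bot filterlim_compose[OF filterlim_uminus_at_bot_at_top w(3)]])
    then have "(\<lambda>N. exp (- w (N - 1))) \<longlonglongrightarrow> 0"
      by (rule filterlim_compose[OF _ filterlim_minus_const_nat_at_top])
    then show "\<epsilon> \<longlonglongrightarrow> 0"
      unfolding \<epsilon>_def using q by (auto intro!: tendsto_divide_zero tendsto_mult_right_zero)
    fix j assume j: "J \<le> j"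
    show "\<exists>X. \<forall>x\<ge>X. x \<notin> E \<longrightarrow> (\<exists>N\<ge>j. a N \<noteq> 0 \<and> central_index lam a x = N \<and>
        (\<Sum>n. norm (a n) * exp (x * lam n)) - norm (a N) * exp (x * lam N)
          \<le> \<epsilon> N * (norm (a N) * exp (x * lam N)))"
    proof (rule exI[of _ "u j + 1"], intro allI impI)
      fix x assume x: "u j + 1 \<le> x" "x \<notin> E"
      have outside: "x \<notin> {R i + P i..R i + P (Suc i)}" if "j \<le> i" for i
      proof
        assume "x \<in> {R i + P i..R i + P (Suc i)}"
        then have "x \<in> {u (i - J + J)..v' (i - J + J)}"
          using j that by (simp add: u_def v'_def)
        then show False
          using x(2) unfolding E_def B_def by blast
      qed
      obtain N where N: "j < N"
        and max: "\<And>n. b n * exp ((x - P N) * lam n) \<le> b N * exp ((x - P N) * lam N)"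
      proof (rule maximizer_outside_gaps[OF lam(2) b0 maximizer, of j P x])
        show "bdd_above (dominated_upto lam b i)" if "j \<le> i" for i
          using that j by (intro bdd) simp
        show "dominated_upto lam b j \<noteq> {}"
          using dom0[OF j] by blast
        show "Sup (dominated_upto lam b j) + P j < x"
          using x(1) by (simp add: u_def R_def)
        show "x \<notin> {Sup (dominated_upto lam b i) + P i..Sup (dominated_upto lam b i) + P (Suc i)}"
          if "j \<le> i" for i
          using outside[OF that] by (simp add: R_def)
      qed (rule P_mono P0 that; assumption)+
      have iso: "norm (a n) * exp (x * lam n)
          \<le> norm (a N) * exp (x * lam N) * exp (- \<bar>(\<Sum>k<n. w k) - (\<Sum>k<N. w k)\<bar>)" for n
        using isolation_of_lifted_maximizer[of lam \<tau> "\<lambda>n. norm (a n)" N n "x - P N", OF lam_mono \<tau>0]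
          max[of n] by (simp add: b_def W P_def)
      have iso': "norm (a n) * exp (x * lam n)
          \<le> norm (a N) * exp (x * lam N) * exp (- w (N - 1)) * q ^ ((n - N) + (N - n) - 1)"
        if "n \<noteq> N" for n
      proof -
        have "exp (- \<bar>(\<Sum>k<n. w k) - (\<Sum>k<N. w k)\<bar>)
          \<le> exp (- (w (N - 1) + real ((n - N) + (N - n) - 1) * w 0))"
          using partial_sum_gap_ge[OF w(1,2) that] by simp
        also have "\<dots> = exp (- w (N - 1)) * q ^ ((n - N) + (N - n) - 1)"
          by (simp add: q_def exp_of_nat_mult[symmetric] exp_add[symmetric])
        finally have "norm (a N) * exp (x * lam N) * exp (- \<bar>(\<Sum>k<n. w k) - (\<Sum>k<N. w k)\<bar>)
            \<le> norm (a N) * exp (x * lam N) * (exp (- w (N - 1)) * q ^ ((n - N) + (N - n) - 1))"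
          by (rule mult_left_mono) simp
        with iso[of n] show ?thesis
          by (simp only: mult.assoc)
      qed
      have aN: "a N \<noteq> 0"
      proof
        assume "a N = 0"
        then have "b m \<le> 0"
          using max[of m] by (simp add: b_def mult_le_0_iff)
        then show False
          using m ab[of m] by (smt (verit) zero_less_norm_iff)
      qed
      have "central_index lam a x = N"
      proof (rule central_index_eqI)
        fix n assume "n \<noteq> N"
        have "0 < w (N - 1) + real ((n - N) + (N - n) - 1) * w 0"
          using w(2) by (intro add_pos_nonneg) (auto simp: less_imp_le)
        then have "exp (- \<bar>(\<Sum>k<n. w k) - (\<Sum>k<N. w k)\<bar>) < 1"
          using partial_sum_gap_ge[OF w(1,2) \<open>n \<noteq> N\<close>] by simp
        then have "norm (a N) * exp (x * lam N) * exp (- \<bar>(\<Sum>k<n. w k) - (\<Sum>k<N. w k)\<bar>)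
            < norm (a N) * exp (x * lam N) * 1"
          using aN by (intro mult_strict_left_mono) auto
        then show "norm (a n) * exp (x * lam n) < norm (a N) * exp (x * lam N)"
          using iso[of n] by simp
      qed
      moreover have "(\<Sum>n. norm (a n) * exp (x * lam n)) - norm (a N) * exp (x * lam N)
          \<le> 2 * (norm (a N) * exp (x * lam N) * exp (- w (N - 1))) / (1 - q)"
        using q iso' by (intro suminf_minus_term_le class_D_norm_summable[OF aD]) auto
      ultimately show "\<exists>N\<ge>j. a N \<noteq> 0 \<and> central_index lam a x = N \<and>
        (\<Sum>n. norm (a n) * exp (x * lam n)) - norm (a N) * exp (x * lam N)
          \<le> \<epsilon> N * (norm (a N) * exp (x * lam N))"
        using aN N by (intro exI[of _ N]) (simp add: \<epsilon>_def mult_ac)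
    qed
  qed
  ultimately show ?thesis
    by blast
qed

section \<open>Series with prescribed jumps of the central index\<close>

text \<open>
  Coefficients, normalized to \<open>1\<close> at index \<open>0\<close>, for which the terms with exponents
  \<open>l k\<close> and \<open>l (Suc k)\<close> are equal at \<open>R k\<close>.
\<close>

definition jump_coeff :: "(nat \<Rightarrow> real) \<Rightarrow> (nat \<Rightarrow> real) \<Rightarrow> nat \<Rightarrow> real" where
  "jump_coeff l R k = exp (- (\<Sum>j<k. R j * (l (Suc j) - l j)))"

lemma jump_term_Suc:
  "jump_coeff l R (Suc k) * exp (x * l (Suc k))
     = jump_coeff l R k * exp (x * l k) * exp ((x - R k) * (l (Suc k) - l k))"
  by (simp add: jump_coeff_def algebra_simps flip: exp_add)

lemma jump_term_mono:
  assumes "mono l" and "k \<le> n" and "\<And>j. j < n \<Longrightarrow> R j \<le> x"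
  shows "jump_coeff l R k * exp (x * l k) \<le> jump_coeff l R n * exp (x * l n)"
  using assms(2)
proof (induction k rule: inc_induct)
  case (step k)
  have "0 \<le> (x - R k) * (l (Suc k) - l k)"
    using assms(3)[OF step(2)] monoD[OF assms(1), of k "Suc k"] by simp
  then have "jump_coeff l R k * exp (x * l k) * 1 \<le> jump_coeff l R (Suc k) * exp (x * l (Suc k))"
    unfolding jump_term_Suc by (intro mult_left_mono) (auto simp: jump_coeff_def)
  then show ?case
    using step.IH by simp
qed simp

lemma jump_term_antimono:
  assumes "mono l" and "n \<le> k" and "\<And>j. n \<le> j \<Longrightarrow> x \<le> R j"
  shows "jump_coeff l R k * exp (x * l k) \<le> jump_coeff l R n * exp (x * l n)"
  using assms(2)
proof (induction k rule: dec_induct)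
  case (step k)
  have "(x - R k) * (l (Suc k) - l k) \<le> 0"
    using assms(3)[OF step(1)] monoD[OF assms(1), of k "Suc k"] by (intro mult_nonpos_nonneg) auto
  then have "jump_coeff l R (Suc k) * exp (x * l (Suc k)) \<le> jump_coeff l R k * exp (x * l k) * 1"
    unfolding jump_term_Suc by (intro mult_left_mono) (auto simp: jump_coeff_def)
  then show ?case
    using step.IH by simp
qed simp

text \<open>
  At \<open>x + 1\<close> the terms are bounded, and passing to \<open>x\<close> multiplies the
  \<open>k\<close>-th one by \<open>exp (- l k)\<close>.
\<close>

lemma summable_jump_terms:
  assumes "mono l" and "filterlim R at_top sequentially" and "summable (\<lambda>k. exp (- l k))"
  shows "summable (\<lambda>k. jump_coeff l R k * exp (x * l k))"
proof -
  obtain K where K: "\<And>j. K \<le> j \<Longrightarrow> x + 1 \<le> R j"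
    using assms(2) unfolding filterlim_at_top eventually_sequentially by blast
  have "norm (jump_coeff l R k * exp (x * l k))
      \<le> (jump_coeff l R K * exp ((x + 1) * l K)) * exp (- l k)" if "K \<le> k" for k
  proof -
    have "jump_coeff l R k * exp (x * l k) = (jump_coeff l R k * exp ((x + 1) * l k)) * exp (- l k)"
      by (simp add: algebra_simps flip: exp_add)
    also have "\<dots> \<le> (jump_coeff l R K * exp ((x + 1) * l K)) * exp (- l k)"
      using K by (intro mult_right_mono jump_term_antimono[OF assms(1) that]) auto
    finally show ?thesis
      by (simp add: jump_coeff_def)
  qed
  then show ?thesis
    by (rule summable_comparison_test'[OF summable_mult[OF assms(3)]])
qed

definition jump_series :: "(nat \<Rightarrow> real) \<Rightarrow> (nat \<Rightarrow> nat) \<Rightarrow> (nat \<Rightarrow> real) \<Rightarrow> nat \<Rightarrow> complex" where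
  "jump_series lam m R n =
     (if n \<in> range m then of_real (jump_coeff (\<lambda>k. lam (m k)) R (inv m n)) else 0)"

lemma jump_series_on: "inj m \<Longrightarrow> jump_series lam m R (m k) = of_real (jump_coeff (\<lambda>k. lam (m k)) R k)"
  by (simp add: jump_series_def)

lemma jump_series_off: "n \<notin> range m \<Longrightarrow> jump_series lam m R n = 0"
  by (simp add: jump_series_def)

lemma jump_series_norm: "jump_series lam m R n = of_real (norm (jump_series lam m R n))"
  by (simp add: jump_series_def jump_coeff_def)

lemma jump_series_in_class_D:
  assumes "mono lam" and "strict_mono m" and "filterlim R at_top sequentially"
    and "summable (\<lambda>k. exp (- lam (m k)))"
  shows "jump_series lam m R \<in> class_D lam"
  unfolding class_D_def
proof (intro CollectI allI)
  fix z :: complex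
  have inj: "inj m"
    using assms(2) by (rule strict_mono_imp_inj_on)
  have mono: "mono (\<lambda>k. lam (m k))"
    using assms(1) strict_mono_mono[OF assms(2)] by (simp add: mono_def)
  have "summable (\<lambda>k. norm (jump_series lam m R (m k) * exp (z * of_real (lam (m k)))))"
    using summable_jump_terms[OF mono assms(3,4), of "Re z"]
    by (simp add: jump_series_on[OF inj] norm_mult) (simp add: jump_coeff_def)
  then show "summable (\<lambda>n. norm (jump_series lam m R n * exp (z * of_real (lam n))))"
    by (subst (asm) summable_mono_reindex[OF assms(2)]) (simp_all add: jump_series_off)
qed

lemma max_term_jump_series:
  assumes "mono lam" and "strict_mono m" and "mono R" and "R n < x" and "x \<le> R (Suc n)"
  shows "max_term lam (jump_series lam m R) x
    = jump_coeff (\<lambda>k. lam (m k)) R (Suc n) * exp (x * lam (m (Suc n)))"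
proof -
  have inj: "inj m"
    using assms(2) by (rule strict_mono_imp_inj_on)
  have mono: "mono (\<lambda>k. lam (m k))"
    using assms(1) strict_mono_mono[OF assms(2)] by (simp add: mono_def)
  have norm_on: "norm (jump_series lam m R (m k)) = jump_coeff (\<lambda>k. lam (m k)) R k" for k
    by (simp add: jump_series_on[OF inj]) (simp add: jump_coeff_def)
  have below: "R j \<le> x" if "j < Suc n" for j
    using monoD[OF assms(3), of j n] that assms(4) by simp
  have above: "x \<le> R j" if "Suc n \<le> j" for j
    using monoD[OF assms(3) that] assms(5) by simp
  have "norm (jump_series lam m R i) * exp (x * lam i)
      \<le> norm (jump_series lam m R (m (Suc n))) * exp (x * lam (m (Suc n)))" for i
  proof (cases "i \<in> range m")
    case True
    then obtain k where k: "i = m k" by blast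
    show ?thesis
      unfolding k norm_on using jump_term_mono[OF mono, of k "Suc n" R x, OF _ below]
        jump_term_antimono[OF mono, of "Suc n" k x R, OF _ above]
      by (cases "k \<le> Suc n") auto
  qed (simp add: jump_series_off)
  then have "max_term lam (jump_series lam m R) x
      = norm (jump_series lam m R (m (Suc n))) * exp (x * lam (m (Suc n)))"
    by (rule max_term_eqI)
  then show ?thesis
    by (simp only: norm_on)
qed

text \<open>
  Let \<open>k\<close> be the central position at \<open>x / 2\<close>. The \<open>k\<close>-th term is at least
  \<open>1\<close> at \<open>x / 2\<close>, where it beats the initial one, and it grows by the factor
  \<open>exp (x / 2 * lam (m k))\<close> up to \<open>x\<close>. The bound on \<open>R k\<close>, which is at
  least \<open>x / 2\<close>, turns into a lower bound for \<open>lam (m k)\<close>.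
\<close>

lemma jump_series_in_class_D1:
  assumes lam: "mono lam" "\<And>n. 0 \<le> lam n" and m: "strict_mono m"
    and R: "filterlim R at_top sequentially"
    and "summable (\<lambda>k. exp (- lam (m k)))" and "0 < c"
    and R_le: "\<And>k. \<Phi> 0 \<le> c * lam (m k)" "\<And>k. R k \<le> 2 * (c * inverse_Ici \<Phi> (c * lam (m k)))"
    and \<Phi>: "\<Phi> \<in> class_L"
  shows "jump_series lam m R \<in> class_D1 lam \<Phi>"
proof -
  define a where "a = jump_series lam m R"
  have aD: "a \<in> class_D lam"
    unfolding a_def by (rule jump_series_in_class_D[OF lam(1) m R assms(5)])
  have inj: "inj m"
    using m by (rule strict_mono_imp_inj_on)
  have mono: "mono (\<lambda>k. lam (m k))"
    using lam(1) strict_mono_mono[OF m] by (simp add: mono_def)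
  have "1 / (2 * c) * x * \<Phi> (1 / (4 * c) * x) \<le> ln (max_term lam a x)" if "0 < x" for x
  proof -
    obtain k0 where k0: "x / 2 \<le> R k0"
      using R unfolding filterlim_at_top eventually_sequentially by blast
    define k where "k = (LEAST k. x / 2 \<le> R k)"
    have k: "x / 2 \<le> R k"
      unfolding k_def using k0 by (rule LeastI)
    have k_least: "R j \<le> x / 2" if "j < k" for j
      using not_less_Least[of j "\<lambda>k. x / 2 \<le> R k"] that unfolding k_def by simp
    have "1 \<le> jump_coeff (\<lambda>k. lam (m k)) R 0 * exp (x / 2 * lam (m 0))"
      using lam(2) that by (simp add: jump_coeff_def)
    also have "\<dots> \<le> jump_coeff (\<lambda>k. lam (m k)) R k * exp (x / 2 * lam (m k))"
      using k_least by (intro jump_term_mono[OF mono]) auto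
    finally have "1 * exp (x / 2 * lam (m k))
        \<le> jump_coeff (\<lambda>k. lam (m k)) R k * exp (x / 2 * lam (m k)) * exp (x / 2 * lam (m k))"
      by (rule mult_right_mono) simp
    also have "\<dots> = norm (a (m k)) * exp (x * lam (m k))"
      by (simp add: a_def jump_series_on[OF inj] mult.assoc flip: exp_add) (simp add: jump_coeff_def)
    also have "\<dots> \<le> max_term lam a x"
      by (rule term_le_max_term[OF aD])
    finally have max_ge: "exp (x / 2 * lam (m k)) \<le> max_term lam a x"
      by simp
    then have "ln (exp (x / 2 * lam (m k))) \<le> ln (max_term lam a x)"
      by (subst ln_le_cancel_iff) (auto intro: less_le_trans[OF exp_gt_zero])
    then have ln_ge: "x / 2 * lam (m k) \<le> ln (max_term lam a x)"
      by simp
    have "1 / (4 * c) * x \<le> inverse_Ici \<Phi> (c * lam (m k))"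
      using k R_le(2)[of k] assms(6) by (simp add: field_simps)
    then have "\<Phi> (1 / (4 * c) * x) \<le> c * lam (m k)"
      using le_inverse_Ici_iff[OF \<Phi> R_le(1)[of k], of "1 / (4 * c) * x"] assms(6) that by simp
    then have "1 / (2 * c) * x * \<Phi> (1 / (4 * c) * x) \<le> 1 / (2 * c) * x * (c * lam (m k))"
      using assms(6) that by (intro mult_left_mono) auto
    also have "\<dots> = x / 2 * lam (m k)"
      using assms(6) by simp
    also note ln_ge
    finally show ?thesis .
  qed
  moreover have "0 < 1 / (2 * c)" "0 < 1 / (4 * c)"
    using assms(6) by simp_all
  ultimately have "\<exists>K1>0. \<exists>K2>0. \<exists>x0\<ge>0. \<forall>x>x0. K1 * x * \<Phi> (K2 * x) \<le> ln (max_term lam a x)"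
    by blast
  then show ?thesis
    using aD by (simp add: class_D1_def a_def)
qed

text \<open>
  At such a point the maximal term is the one of position \<open>n + 1\<close>, and its predecessor is
  smaller by a factor of at most \<open>e \<le> 3\<close>. All coefficients are non-negative, so at
  \<open>y = 0\<close> the sum is at least \<open>4/3\<close> times the maximal term, whereas an
  \<open>o(1)\<close> term below \<open>1/4\<close> allows only the factor \<open>5/4\<close>.
\<close>

lemma jump_series_exceptional:
  assumes lam: "strict_mono lam" and m: "strict_mono m" and "mono R"
    and R: "filterlim R at_top sequentially" and "summable (\<lambda>k. exp (- lam (m k)))"
    and "asymp_central_term lam (jump_series lam m R) E"
  obtains X where "\<And>n x. X \<le> x \<Longrightarrow> R n < x \<Longrightarrow> x \<le> R (Suc n)
    \<Longrightarrow> x \<le> R n + 1 / (lam (m (Suc n)) - lam (m n)) \<Longrightarrow> x \<in> E"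
proof -
  define a where "a = jump_series lam m R"
  define F where "F x = (\<Sum>n. norm (a n) * exp (x * lam n))" for x
  have lam_mono: "mono lam"
    using lam by (rule strict_mono_mono)
  have aD: "a \<in> class_D lam"
    unfolding a_def by (rule jump_series_in_class_D[OF lam_mono m R assms(5)])
  have inj: "inj m"
    using m by (rule strict_mono_imp_inj_on)
  have norm_on: "norm (a (m k)) = jump_coeff (\<lambda>k. lam (m k)) R k" for k
    by (simp add: a_def jump_series_on[OF inj]) (simp add: jump_coeff_def)
  have F: "norm (dirichlet_series lam a (Complex x 0)) = F x" for x
  proof -
    have "exp (Complex x 0 * of_real (lam n)) = of_real (exp (x * lam n))" for n
      by (simp add: exp_of_real complex_of_real_def[symmetric] flip: of_real_mult)
    then have "a n * exp (Complex x 0 * of_real (lam n)) = of_real (norm (a n) * exp (x * lam n))" for n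
      using jump_series_norm[of lam m R n] by (simp add: a_def)
    then have "dirichlet_series lam a (Complex x 0) = of_real (F x)"
      using class_D_norm_summable[OF aD] unfolding dirichlet_series_def F_def
      by (simp only: suminf_of_real)
    moreover have "0 \<le> F x"
      unfolding F_def by (intro suminf_nonneg class_D_norm_summable[OF aD]) simp
    ultimately show ?thesis by simp
  qed
  obtain r where r1: "\<forall>\<^sub>F x in inf at_top (principal (- E)). \<forall>y.
      dirichlet_series lam a (Complex x y) = (1 + r x y) * (a (central_index lam a x) *
               exp (Complex x y * of_real (lam (central_index lam a x))))"
    and r2: "uniform_limit UNIV r (\<lambda>_. 0) (inf at_top (principal (- E)))"
    using assms(6) unfolding asymp_central_term_def a_def by blast
  have r2': "\<forall>\<^sub>F x in inf at_top (principal (- E)). \<forall>y\<in>UNIV. dist (r x y) 0 < 1 / 4"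
    using uniform_limitD[OF r2, of "1/4"] by simp
  obtain X where X: "\<And>x. X \<le> x \<Longrightarrow> x \<notin> E \<Longrightarrow>
      (\<forall>y. dirichlet_series lam a (Complex x y) = (1 + r x y) * (a (central_index lam a x) *
               exp (Complex x y * of_real (lam (central_index lam a x))))) \<and>
      (\<forall>y\<in>UNIV. dist (r x y) 0 < 1 / 4)"
    using eventually_conj[OF r1 r2'] unfolding eventually_at_top_inf_principal by blast
  have "x \<in> E" if x: "X \<le> x" "R n < x" "x \<le> R (Suc n)"
    "x \<le> R n + 1 / (lam (m (Suc n)) - lam (m n))" for x n
  proof (rule ccontr)
    assume "x \<notin> E"
    define \<mu> where "\<mu> = jump_coeff (\<lambda>k. lam (m k)) R (Suc n) * exp (x * lam (m (Suc n)))"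
    have max: "max_term lam a x = \<mu>"
      unfolding a_def \<mu>_def by (rule max_term_jump_series[OF lam_mono m assms(3) x(2,3)])
    have \<mu>: "0 < \<mu>"
      by (simp add: \<mu>_def jump_coeff_def)
    have "F x = norm ((1 + r x 0) * (a (central_index lam a x) *
               exp (Complex x 0 * of_real (lam (central_index lam a x)))))"
      using X[OF x(1) \<open>x \<notin> E\<close>] F[of x] by simp
    also have "\<dots> = norm (1 + r x 0) * (norm (a (central_index lam a x)) * exp (x * lam (central_index lam a x)))"
      by (simp add: norm_mult)
    also have "\<dots> = norm (1 + r x 0) * \<mu>"
      using central_index_attains[OF aD, of x] \<mu> by (simp add: max)
    also have "\<dots> \<le> (5 / 4) * \<mu>"
    proof (rule mult_right_mono)
      have "norm (r x 0) < 1 / 4"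
        using X[OF x(1) \<open>x \<notin> E\<close>] by simp
      then show "norm (1 + r x 0) \<le> 5 / 4"
        using norm_triangle_ineq[of 1 "r x 0"] by simp
    qed (use \<mu> in simp)
    finally have upper: "F x \<le> 5 / 4 * \<mu>" .
    have gap: "0 < lam (m (Suc n)) - lam (m n)"
      using lam m by (simp add: strict_mono_less)
    have "exp ((x - R n) * (lam (m (Suc n)) - lam (m n))) \<le> 3"
    proof -
      have "(x - R n) * (lam (m (Suc n)) - lam (m n)) \<le> 1"
        using x(4) gap by (simp add: field_simps)
      then show ?thesis
        using exp_le order_trans exp_le_cancel_iff by blast
    qed
    then have "\<mu> \<le> jump_coeff (\<lambda>k. lam (m k)) R n * exp (x * lam (m n)) * 3"
      unfolding \<mu>_def jump_term_Suc[of "\<lambda>k. lam (m k)"] by (intro mult_left_mono) (auto simp: jump_coeff_def)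
    then have "\<mu> / 3 + \<mu> \<le> norm (a (m n)) * exp (x * lam (m n)) + norm (a (m (Suc n))) * exp (x * lam (m (Suc n)))"
      by (simp add: norm_on \<mu>_def mult.commute)
    also have "\<dots> = (\<Sum>i\<in>{m n, m (Suc n)}. norm (a i) * exp (x * lam i))"
      using inj by (simp add: inj_eq)
    also have "\<dots> \<le> F x"
      unfolding F_def by (intro sum_le_suminf class_D_norm_summable[OF aD]) auto
    finally show False
      using upper \<mu> by simp
  qed
  then show thesis
    by (rule that)
qed


section \<open>Jumps with an exceptional set of infinite \<open>h\<close>-measure\<close>

text \<open>
  The next jump is put at the end \<open>greedy_jumps f d k + d k\<close> of the previous
  exceptional interval, or as close to it as the bounds \<open>f\<close> and \<open>2 * f\<close> permit.
\<close>

fun greedy_jumps :: "(nat \<Rightarrow> real) \<Rightarrow> (nat \<Rightarrow> real) \<Rightarrow> nat \<Rightarrow> real" where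
  "greedy_jumps f d 0 = f 0"
| "greedy_jumps f d (Suc k) = max (f (Suc k)) (min (2 * f (Suc k)) (greedy_jumps f d k + d k))"

context
  fixes f d :: "nat \<Rightarrow> real"
  assumes f: "mono f" "0 < f 0" and d: "\<And>k. 0 < d k"
begin

private lemma f_pos: "0 < f k"
  using f(2) monoD[OF f(1), of 0 k] by simp

lemma greedy_jumps_bounds: "f k \<le> greedy_jumps f d k" "greedy_jumps f d k \<le> 2 * f k"
  using f_pos[of k] by (cases k; simp)+

lemma greedy_jumps_mono: "mono (greedy_jumps f d)"
  unfolding mono_iff_le_Suc
proof
  fix k
  show "greedy_jumps f d k \<le> greedy_jumps f d (Suc k)"
    using greedy_jumps_bounds(2)[of k] monoD[OF f(1), of k "Suc k"] d[of k] by simp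
qed

text \<open>
  By assumption the cap \<open>2 * f (Suc n)\<close> is active. No jump in \<open>(f (Suc n), 2 * f (Suc n)]\<close> up to
  the \<open>(n + 1)\<close>-st one can have been raised to its lower bound \<open>f\<close>, so each is at most
  the right end of the preceding exceptional interval, and there are no holes.
\<close>

lemma greedy_jumps_cover:
  assumes "greedy_jumps f d (Suc n) < greedy_jumps f d n + d n"
    and x: "f (Suc n) < x" "x \<le> 2 * f (Suc n)"
  obtains k where "greedy_jumps f d k < x" and "x \<le> greedy_jumps f d (Suc k)"
    and "x \<le> greedy_jumps f d k + d k"
proof -
  have top: "greedy_jumps f d (Suc n) = 2 * f (Suc n)"
    using assms(1) greedy_jumps_bounds(2)[of "Suc n"] by auto
  define k where "k = (LEAST k. x \<le> greedy_jumps f d (Suc k))"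
  have ex: "x \<le> greedy_jumps f d (Suc n)"
    using x(2) top by simp
  have le: "x \<le> greedy_jumps f d (Suc k)"
    unfolding k_def by (rule LeastI, rule ex)
  have "k \<le> n"
    unfolding k_def by (rule Least_le, rule ex)
  then have "f (Suc k) \<le> f (Suc n)"
    by (intro monoD[OF f(1)]) simp
  then have "f (Suc k) < x"
    using x(1) by simp
  moreover have "greedy_jumps f d k < x"
  proof (cases k)
    case 0
    then show ?thesis
      using monoD[OF f(1), of 0 "Suc n"] x(1) by simp
  next
    case (Suc j)
    then show ?thesis
      using not_less_Least[of j "\<lambda>k. x \<le> greedy_jumps f d (Suc k)"] unfolding k_def[symmetric]
      by (simp add: not_le del: greedy_jumps.simps)
  qed
  ultimately show thesis
    using that[of k] le by simp
qed

end

text \<open>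
  If the cap \<open>2 * f\<close> is active only finitely often, the exceptional intervals are eventually
  disjoint and their \<open>h\<close>-measures dominate the terms of the divergent series. Otherwise
  \<open>E\<close> contains \<open>(y, 2 * y]\<close> for arbitrarily large values \<open>y\<close> of
  \<open>f\<close>, and the \<open>h\<close>-measure of this interval is at least \<open>h'(f 0) * y\<close>.
\<close>

lemma greedy_jumps_infinite_h_measure:
  assumes h: "h \<in> class_L_plus" and f: "mono f" "0 < f 0" "filterlim f at_top sequentially"
    and d: "\<And>k. 0 < d k" and div: "\<not> summable (\<lambda>k. deriv_Ici h (f k) * d k)"
    and E: "E \<in> sets (h_measure h)"
    and sub: "\<And>k x. X \<le> x \<Longrightarrow> greedy_jumps f d k < x \<Longrightarrow> x \<le> greedy_jumps f d (Suc k)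
      \<Longrightarrow> x \<le> greedy_jumps f d k + d k \<Longrightarrow> x \<in> E"
  shows "emeasure (h_measure h) E = \<infinity>"
proof (rule ccontr)
  assume "emeasure (h_measure h) E \<noteq> \<infinity>"
  then obtain e where e: "0 \<le> e" "emeasure (h_measure h) E = ennreal e"
    by (cases "emeasure (h_measure h) E") auto
  define R where "R = greedy_jumps f d"
  note bounds = greedy_jumps_bounds[of f d, OF f(1,2) d, folded R_def]
  have R_mono: "mono R"
    unfolding R_def by (rule greedy_jumps_mono[OF f(1,2) d])
  have f_pos: "0 < f k" for k
    using f(2) monoD[OF f(1), of 0 k] by simp
  have D0: "0 < deriv_Ici h (f k)" for k
    by (rule class_L_plus_deriv_pos[OF h f_pos])
  show False
  proof (cases "\<exists>K. \<forall>k\<ge>K. R k + d k \<le> R (Suc k)")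
    case True
    then obtain K where K: "\<And>k. K \<le> k \<Longrightarrow> R k + d k \<le> R (Suc k)" by blast
    obtain K' where K': "\<And>k. K' \<le> k \<Longrightarrow> X \<le> f k"
      using f(3) unfolding filterlim_at_top eventually_sequentially by blast
    define N where "N = max K K'"
    define I where "I i = {R (i + N)<..R (i + N) + d (i + N)}" for i
    have "disjoint_family I"
      unfolding disjoint_family_on_def
    proof (intro ballI impI)
      have "I i \<inter> I j = {}" if "i < j" for i j
      proof -
        have "R (i + N) + d (i + N) \<le> R (Suc (i + N))"
          by (rule K) (simp add: N_def)
        also have "\<dots> \<le> R (j + N)"
          using that by (intro monoD[OF R_mono]) simp
        finally show ?thesis by (auto simp: I_def)
      qed
      then show "I i \<inter> I j = {}" if "i \<noteq> j" for i j
        using that by (metis Int_commute nat_neq_iff)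
    qed
    moreover have I_sets: "I i \<in> sets (h_measure h)" for i
      unfolding I_def by (rule sets_h_measure_borel[OF h]) simp
    ultimately have "(\<Sum>i. emeasure (h_measure h) (I i)) = emeasure (h_measure h) (\<Union>i. I i)"
      by (intro suminf_emeasure) auto
    also have "\<dots> \<le> emeasure (h_measure h) E"
    proof (rule emeasure_mono[OF _ E], rule UN_least, rule subsetI)
      fix i x assume x: "x \<in> I i"
      have "X \<le> R (i + N)"
        using K'[of "i + N"] bounds(1)[of "i + N"] unfolding N_def by linarith
      moreover have "R (i + N) + d (i + N) \<le> R (Suc (i + N))"
        by (rule K) (simp add: N_def)
      ultimately show "x \<in> E"
        using x sub[of x "i + N"] by (simp add: I_def R_def)
    qed
    finally have total: "(\<Sum>i. emeasure (h_measure h) (I i)) \<le> ennreal e"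
      using e by simp
    have "ennreal (deriv_Ici h (f (i + N)) * d (i + N)) \<le> emeasure (h_measure h) (I i)" for i
    proof -
      let ?k = "i + N"
      have R0: "0 \<le> R ?k" "R ?k \<le> R ?k + d ?k"
        using f_pos[of ?k] bounds(1)[of ?k] d[of ?k] by simp_all
      have "deriv_Ici h (f ?k) * d ?k \<le> deriv_Ici h (R ?k) * d ?k"
        using bounds(1)[of ?k] f_pos[of ?k] d[of ?k]
        by (intro mult_right_mono class_L_plus_deriv_mono[OF h]) auto
      also have "\<dots> \<le> h (R ?k + d ?k) - h (R ?k)"
        using class_L_plus_increment(1)[OF h R0] by simp
      finally show ?thesis
        unfolding I_def emeasure_h_measure_Ioc[OF h R0] by (rule ennreal_leI)
    qed
    then have "(\<Sum>i. ennreal (deriv_Ici h (f (i + N)) * d (i + N)))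
        \<le> (\<Sum>i. emeasure (h_measure h) (I i))"
      by (intro suminf_le) auto
    with total have "(\<Sum>i. ennreal (deriv_Ici h (f (i + N)) * d (i + N))) \<noteq> top"
      by (metis ennreal_less_top leD order_trans)
    then have "summable (\<lambda>i. deriv_Ici h (f (i + N)) * d (i + N))"
      using D0 d by (intro summable_suminf_not_top) (auto simp: less_imp_le)
    with div show False
      using summable_iff_shift[of "\<lambda>k. deriv_Ici h (f k) * d k" N] by simp
  next
    case False
    obtain K where K: "\<And>k. K \<le> k \<Longrightarrow> max X ((e + 1) / deriv_Ici h (f 0)) \<le> f k"
      using f(3) unfolding filterlim_at_top eventually_sequentially by blast
    obtain n where n: "K \<le> n" "R (Suc n) < R n + d n"
      using False by (auto simp: not_le)
    define y where "y = f (Suc n)"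
    have y: "0 < y" "X \<le> y" "e + 1 \<le> deriv_Ici h (f 0) * y"
      using K[of "Suc n"] n(1) f_pos[of "Suc n"] D0[of 0] by (auto simp: y_def field_simps)
    have "{y<..2 * y} \<subseteq> E"
    proof
      fix x assume x: "x \<in> {y<..2 * y}"
      obtain k where "greedy_jumps f d k < x" "x \<le> greedy_jumps f d (Suc k)" "x \<le> greedy_jumps f d k + d k"
        by (rule greedy_jumps_cover[of f d n x, OF f(1,2) d]) (use n(2) x in \<open>auto simp: y_def R_def simp del: greedy_jumps.simps\<close>)
      then show "x \<in> E"
        using x y(2) by (intro sub) auto
    qed
    then have "emeasure (h_measure h) {y<..2 * y} \<le> ennreal e"
      unfolding e(2)[symmetric] using E by (rule emeasure_mono)
    moreover have "e < h (2 * y) - h y"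
    proof -
      have "deriv_Ici h (f 0) * y \<le> deriv_Ici h y * y"
        using y(1) monoD[OF f(1), of 0 "Suc n"] f(2)
        by (intro mult_right_mono class_L_plus_deriv_mono[OF h]) (auto simp: y_def)
      also have "\<dots> \<le> h (2 * y) - h y"
        using class_L_plus_increment(1)[OF h, of y "2 * y"] y(1) by simp
      finally show ?thesis
        using y(3) by linarith
    qed
    ultimately show False
      using y(1) e(1) by (simp add: emeasure_h_measure_Ioc[OF h])
  qed
qed

section \<open>The equivalence\<close>

text \<open>
  Divergence along a subsequence of the exponents suffices, since the extremal series may
  give all other exponents the coefficient \<open>0\<close>. The condition \<open>\<Phi> 1 \<le> c * lam (m 0)\<close>
  keeps the lower bounds for the jumps positive.
\<close>

lemma divergent_subsequence_imp_extremal: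
  assumes lam: "lam 0 = 0" "strict_mono lam"
    and \<Phi>: "\<Phi> \<in> class_L" and h: "h \<in> class_L_plus" and "0 < c"
    and m: "strict_mono m" and m0: "\<Phi> 1 \<le> c * lam (m 0)"
    and "filterlim lam at_top sequentially"
    and "summable (\<lambda>k. exp (- lam (m k)))"
    and div: "\<not> summable (\<lambda>k. deriv_Ici h (c * inverse_Ici \<Phi> (c * lam (m k)))
      / (lam (m (Suc k)) - lam (m k)))"
  shows "\<exists>a\<in>class_D1 lam \<Phi>. \<forall>E\<in>sets (h_measure h).
    asymp_central_term lam a E \<longrightarrow> emeasure (h_measure h) E = \<infinity>"
proof -
  define f where "f k = c * inverse_Ici \<Phi> (c * lam (m k))" for k
  define d where "d k = 1 / (lam (m (Suc k)) - lam (m k))" for k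
  define R where "R = greedy_jumps f d"
  have lam_mono: "mono lam"
    using lam(2) by (rule strict_mono_mono)
  have lam0: "0 \<le> lam n" for n
    using monoD[OF lam_mono, of 0 n] lam(1) by simp
  have d: "0 < d k" for k
    using lam(2) m by (simp add: d_def strict_mono_less)
  have "\<Phi> 0 < \<Phi> 1"
    using \<Phi> by (intro strict_mono_onD[of "{0..}" \<Phi>]) (auto simp: class_L_def)
  have ge: "c * lam (m 0) \<le> c * lam (m k)" for k
    using assms(5) monoD[OF lam_mono, of "m 0" "m k"] strict_mono_less_eq[OF m, of 0 k] by simp
  have \<Phi>0: "\<Phi> 0 \<le> c * lam (m k)" for k
    using \<open>\<Phi> 0 < \<Phi> 1\<close> m0 ge[of k] by simp
  have f_mono: "mono f"
  proof (rule monoI)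
    fix j k :: nat assume "j \<le> k"
    then have "c * lam (m j) \<le> c * lam (m k)"
      using assms(5) lam(2) m by (simp add: strict_mono_less_eq)
    then show "f j \<le> f k"
      unfolding f_def using assms(5) by (intro mult_left_mono inverse_Ici_mono[OF \<Phi> \<Phi>0]) auto
  qed
  have "1 \<le> inverse_Ici \<Phi> (c * lam (m 0))"
    using le_inverse_Ici_iff[OF \<Phi> \<Phi>0[of 0], of 1] m0 by simp
  then have f0: "0 < f 0"
    unfolding f_def using assms(5) by simp
  have "filterlim (\<lambda>k. c * lam (m k)) at_top sequentially"
    using assms(5) filterlim_compose[OF assms(8) filterlim_subseq[OF m]]
    by (intro filterlim_tendsto_pos_mult_at_top[OF tendsto_const])
  then have f_lim: "filterlim f at_top sequentially"
    unfolding f_def using assms(5) filterlim_compose[OF inverse_Ici_at_top[OF \<Phi>]]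
    by (intro filterlim_tendsto_pos_mult_at_top[OF tendsto_const]) auto
  note bounds = greedy_jumps_bounds[of f d, OF f_mono f0 d, folded R_def]
  have R_mono: "mono R"
    unfolding R_def by (rule greedy_jumps_mono[OF f_mono f0 d])
  have R_lim: "filterlim R at_top sequentially"
    by (rule filterlim_at_top_mono[OF f_lim always_eventually]) (use bounds(1) in blast)
  have "jump_series lam m R \<in> class_D1 lam \<Phi>"
    using bounds(2) by (intro jump_series_in_class_D1[OF lam_mono lam0 m R_lim assms(9,5) \<Phi>0 _ \<Phi>]) (simp add: f_def)
  moreover have "emeasure (h_measure h) E = \<infinity>"
    if E: "E \<in> sets (h_measure h)" and asymp: "asymp_central_term lam (jump_series lam m R) E" for E
  proof -
    obtain X where X: "\<And>n x. X \<le> x \<Longrightarrow> R n < x \<Longrightarrow> x \<le> R (Suc n)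
        \<Longrightarrow> x \<le> R n + 1 / (lam (m (Suc n)) - lam (m n)) \<Longrightarrow> x \<in> E"
      by (rule jump_series_exceptional[OF lam(2) m R_mono R_lim assms(9) asymp]) (rule that)
    have "\<not> summable (\<lambda>k. deriv_Ici h (f k) * d k)"
      using div by (simp add: f_def d_def)
    then show ?thesis
      by (rule greedy_jumps_infinite_h_measure[OF h f_mono f0 f_lim d _ E X[unfolded R_def d_def[symmetric]]])
  qed
  ultimately show ?thesis
    by blast
qed

lemma summable_exp_minus:
  fixes l :: "nat \<Rightarrow> real"
  assumes "\<And>k. real k / 2 - 1 \<le> l k"
  shows "summable (\<lambda>k. exp (- l k))"
proof (rule summable_comparison_test'[where N = 0])
  show "summable (\<lambda>k. exp 1 * exp (- 1 / 2 :: real) ^ k)"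
    by (intro summable_mult summable_geometric) simp
  fix k
  have "exp (- l k) \<le> exp (1 + real k * (- 1 / 2))"
    using assms[of k] by simp
  then show "norm (exp (- l k)) \<le> exp 1 * exp (- 1 / 2) ^ k"
    by (simp only: exp_add exp_of_nat_mult norm_exp real_norm_def abs_exp_cancel)
qed

text \<open>
  If the gaps eventually exceed \<open>1\<close>, the exponents grow at least linearly and all of them from
  some index on can be used. Otherwise pairs of neighbours \<open>p k\<close>, \<open>p k + 1\<close> at distance at
  most \<open>1\<close> are selected sparsely: the exponents again grow at least linearly, and each
  pair contributes at least \<open>h' c > 0\<close> to the sum.
\<close>

lemma divergent_imp_extremal:
  assumes lam: "lam 0 = 0" "strict_mono lam" "filterlim lam at_top sequentially"
    and \<Phi>: "\<Phi> \<in> class_L" and h: "h \<in> class_L_plus" and c: "0 < c"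
    and div: "\<not> summable (\<lambda>n. if c * lam n < \<Phi> 0 then 0
            else deriv_Ici h (c * inverse_Ici \<Phi> (c * lam n)) / (lam (Suc n) - lam n))"
  shows "\<exists>a\<in>class_D1 lam \<Phi>. \<forall>E\<in>sets (h_measure h).
    asymp_central_term lam a E \<longrightarrow> emeasure (h_measure h) E = \<infinity>"
proof -
  note extremal = divergent_subsequence_imp_extremal[OF lam(1,2) \<Phi> h c _ _ lam(3)]
  have lam0: "0 \<le> lam n" for n
    using lam(1) strict_mono_less_eq[OF lam(2), of 0 n] by simp
  have "filterlim (\<lambda>n. c * lam n) at_top sequentially"
    using c lam(3) by (rule filterlim_tendsto_pos_mult_at_top[OF tendsto_const])
  then obtain n1 where n1: "\<And>n. n1 \<le> n \<Longrightarrow> \<Phi> 1 \<le> c * lam n"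
    unfolding filterlim_at_top eventually_sequentially by blast
  have "\<Phi> 0 < \<Phi> 1"
    using \<Phi> by (intro strict_mono_onD[of "{0..}" \<Phi>]) (auto simp: class_L_def)
  then have n1': "\<Phi> 0 \<le> c * lam n" if "n1 \<le> n" for n
    using n1[OF that] by simp
  show ?thesis
  proof (cases "\<exists>n2. \<forall>n\<ge>n2. 1 < lam (Suc n) - lam n")
    case True
    then obtain n2 where n2: "\<And>n. n2 \<le> n \<Longrightarrow> 1 < lam (Suc n) - lam n" by blast
    define N where "N = max n1 n2"
    define m where "m k = k + N" for k
    have "strict_mono m"
      by (simp add: m_def strict_mono_def)
    moreover have "\<Phi> 1 \<le> c * lam (m 0)"
      by (rule n1) (simp add: m_def N_def)
    moreover have "summable (\<lambda>k. exp (- lam (m k)))"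
    proof (rule summable_exp_minus)
      fix k
      have "real k \<le> lam (k + N)"
      proof (induction k)
        case (Suc k)
        have "1 < lam (Suc (k + N)) - lam (k + N)"
          by (rule n2) (simp add: N_def)
        with Suc show ?case by simp
      qed (simp add: lam0)
      then show "real k / 2 - 1 \<le> lam (m k)"
        by (simp add: m_def)
    qed
    moreover have "\<not> summable (\<lambda>k. deriv_Ici h (c * inverse_Ici \<Phi> (c * lam (m k)))
      / (lam (m (Suc k)) - lam (m k)))"
    proof -
      have "\<not> c * lam (k + N) < \<Phi> 0" for k
        using n1'[of "k + N"] unfolding N_def by linarith
      then show ?thesis
        using div summable_iff_shift[of "\<lambda>n. if c * lam n < \<Phi> 0 then 0
            else deriv_Ici h (c * inverse_Ici \<Phi> (c * lam n)) / (lam (Suc n) - lam n)" N]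
        by (simp add: m_def)
    qed
    ultimately show ?thesis
      by (rule extremal)
  next
    case False
    then have small: "\<exists>n\<ge>N. lam (Suc n) - lam n \<le> 1" for N
      by (auto simp: not_less)
    have next_pair: "\<exists>n\<ge>N. lam (Suc n) - lam n \<le> 1 \<and> y \<le> lam n" for N y
    proof -
      obtain N' where "\<And>n. N' \<le> n \<Longrightarrow> y \<le> lam n"
        using lam(3) unfolding filterlim_at_top eventually_sequentially by blast
      then show ?thesis
        using small[of "max N N'"] by auto
    qed
    have "\<exists>p. \<forall>k. (n1 \<le> p k \<and> lam (Suc (p k)) - lam (p k) \<le> 1 \<and> real k \<le> lam (p k)) \<and> p k + 2 \<le> p (Suc k)"
    proof (rule dependent_nat_choice)
      show "\<exists>n. n1 \<le> n \<and> lam (Suc n) - lam n \<le> 1 \<and> real 0 \<le> lam n"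
        using next_pair[of n1 0] by auto
      show "\<exists>n'. (n1 \<le> n' \<and> lam (Suc n') - lam n' \<le> 1 \<and> real (Suc k) \<le> lam n') \<and> n + 2 \<le> n'" for n k
        using next_pair[of "max n1 (n + 2)" "real (Suc k)"] by auto
    qed
    then obtain p where p: "\<And>k. n1 \<le> p k" "\<And>k. lam (Suc (p k)) - lam (p k) \<le> 1"
      "\<And>k. real k \<le> lam (p k)" "\<And>k. p k + 2 \<le> p (Suc k)"
      by blast
    define m where "m j = p (j div 2) + j mod 2" for j
    have m_even: "m (2 * k) = p k" "m (Suc (2 * k)) = Suc (p k)" for k
      by (simp_all add: m_def)
    have m_mono: "strict_mono m"
      unfolding strict_mono_Suc_iff
    proof
      fix j
      show "m j < m (Suc j)"
      proof (cases "even j")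
        case True
        then show ?thesis by (elim evenE) (simp add: m_even)
      next
        case False
        then obtain k where "j = Suc (2 * k)" by (auto elim: oddE)
        then show ?thesis
          using p(4)[of k] m_even(1)[of "Suc k"] by (simp add: m_even)
      qed
    qed
    moreover have "\<Phi> 1 \<le> c * lam (m 0)"
      using n1[OF p(1)[of 0]] by (simp add: m_def)
    moreover have "summable (\<lambda>k. exp (- lam (m k)))"
    proof (rule summable_exp_minus)
      fix j
      have "real j / 2 - 1 \<le> real (j div 2)"
        by linarith
      also have "\<dots> \<le> lam (p (j div 2))"
        by (rule p)
      also have "\<dots> \<le> lam (m j)"
        using lam(2) by (simp add: strict_mono_less_eq m_def)
      finally show "real j / 2 - 1 \<le> lam (m j)" .
    qed
    moreover have "\<not> summable (\<lambda>k. deriv_Ici h (c * inverse_Ici \<Phi> (c * lam (m k)))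
      / (lam (m (Suc k)) - lam (m k)))" (is "\<not> summable ?t")
    proof
      assume "summable ?t"
      then have lim: "?t \<longlonglongrightarrow> 0"
        by (rule summable_LIMSEQ_zero)
      have "0 < deriv_Ici h c"
        by (rule class_L_plus_deriv_pos[OF h c])
      from order_tendstoD(2)[OF lim this]
      obtain N where N: "\<And>k. N \<le> k \<Longrightarrow> ?t k < deriv_Ici h c"
        unfolding eventually_sequentially by blast
      have "1 \<le> inverse_Ici \<Phi> (c * lam (p N))"
        using le_inverse_Ici_iff[OF \<Phi> n1'[OF p(1)[of N]], of 1] n1[OF p(1)[of N]] by simp
      then have "deriv_Ici h c \<le> deriv_Ici h (c * inverse_Ici \<Phi> (c * lam (p N)))"
        using c by (intro class_L_plus_deriv_mono[OF h]) auto
      moreover have "0 < lam (Suc (p N)) - lam (p N)"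
        using lam(2) by (simp add: strict_mono_less)
      ultimately have "deriv_Ici h c / 1 \<le> ?t (2 * N)"
        unfolding m_even using p(2)[of N] \<open>0 < deriv_Ici h c\<close> by (intro frac_le) auto
      also have "\<dots> < deriv_Ici h c"
        by (rule N) simp
      finally show False by simp
    qed
    ultimately show ?thesis
      by (rule extremal)
  qed
qed

theorem theorem2p5:
  fixes lam :: "nat \<Rightarrow> real" and \<Phi> h :: "real \<Rightarrow> real"
  assumes "lam 0 = 0" and "strict_mono lam" and "filterlim lam at_top sequentially"
    and "\<Phi> \<in> class_L" and "h \<in> class_L_plus"
  shows "(\<forall>a \<in> class_D1 lam \<Phi>. \<exists>E \<in> sets (h_measure h).
            E \<subseteq> {0..} \<and> emeasure (h_measure h) E < \<infinity> \<and> asymp_central_term lam a E) \<longleftrightarrow>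
         (\<forall>b>0. summable (\<lambda>n. if b * lam n < \<Phi> 0 then 0
            else deriv_Ici h (b * inverse_Ici \<Phi> (b * lam n)) / (lam (Suc n) - lam n)))"
proof
  assume asymp: "\<forall>a \<in> class_D1 lam \<Phi>. \<exists>E \<in> sets (h_measure h).
            E \<subseteq> {0..} \<and> emeasure (h_measure h) E < \<infinity> \<and> asymp_central_term lam a E"
  show "\<forall>b>0. summable (\<lambda>n. if b * lam n < \<Phi> 0 then 0
            else deriv_Ici h (b * inverse_Ici \<Phi> (b * lam n)) / (lam (Suc n) - lam n))"
  proof (intro allI impI, rule ccontr)
    fix b :: real
    assume "0 < b" and "\<not> summable (\<lambda>n. if b * lam n < \<Phi> 0 then 0
            else deriv_Ici h (b * inverse_Ici \<Phi> (b * lam n)) / (lam (Suc n) - lam n))"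
    then obtain a where "a \<in> class_D1 lam \<Phi>" and "\<forall>E\<in>sets (h_measure h).
        asymp_central_term lam a E \<longrightarrow> emeasure (h_measure h) E = \<infinity>"
      using divergent_imp_extremal[OF assms] by blast
    with asymp show False
      by (metis less_irrefl)
  qed
next
  assume "\<forall>b>0. summable (\<lambda>n. if b * lam n < \<Phi> 0 then 0
            else deriv_Ici h (b * inverse_Ici \<Phi> (b * lam n)) / (lam (Suc n) - lam n))"
  then show "\<forall>a \<in> class_D1 lam \<Phi>. \<exists>E \<in> sets (h_measure h).
            E \<subseteq> {0..} \<and> emeasure (h_measure h) E < \<infinity> \<and> asymp_central_term lam a E"
    using gap_condition_imp_asymp[OF assms] by blast
qed

end
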